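(* Let $H:\mathcal{D}\to\mathbb{H}^n$ be an analytic Hermitian matrix family in one real variable on an open domain $\mathcal{D}\subseteq\mathbb{R}$, and let $\lambda_{\max}:\mathbb{H}^n\to\mathbb{R}$ denote algebraically largest eigenvalue. Then $\lambda_{\max}\circ H$ is $\mathcal{C}^2$ with Lipschitz second derivative near all of its local maximizers.
   Context: $\mathbb{H}^n$ denotes the space of $n\times n$ complex Hermitian matrices. $H:\mathcal{D}\to\mathbb{H}^n$ is an analytic Hermitian matrix family in one real variable if for all $x\in\mathcal{D}$ and all $i,j\in\{1,\ldots,n\}$ there exist coefficients $a_0,a_1,a_2,\ldots$ such that the power series $\sum_{k=0}^\infty a_k(t-x)^k$ converges to $H_{ij}(t)=\overline{H_{ji}(t)}$ for all $t$ in a neighborhood of $x$. $\mathcal{C}^2$ means twice continuously differentiable; "near" a point means on some neighborhood of that point. *)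

theory Defs
  imports "HOL-Analysis.Analysis" "Jordan_Normal_Form.Spectral_Radius"
begin

definition hermitian_mats :: "nat \<Rightarrow> complex mat set" where
  "hermitian_mats n =
     {A \<in> carrier_mat n n. \<forall>i<n. \<forall>j<n. A $$ (i, j) = cnj (A $$ (j, i))}"

(* H is a total function; its values outside D are unconstrained. *)
definition analytic_hermitian_family :: "nat \<Rightarrow> real set \<Rightarrow> (real \<Rightarrow> complex mat) \<Rightarrow> bool" where
  "analytic_hermitian_family n D H \<longleftrightarrow>
     (\<forall>x\<in>D. H x \<in> hermitian_mats n) \<and>
     (\<forall>x\<in>D. \<forall>i<n. \<forall>j<n. \<exists>a :: nat \<Rightarrow> complex.
        \<forall>\<^sub>F t in nhds x. (\<lambda>k. a k * complex_of_real (t - x) ^ k) sums (H t $$ (i, j)))"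

(* Meaningful for Hermitian A of positive dimension: the set is then finite and nonempty,
   and it contains all eigenvalues of A, as these are real. *)
definition lambda_max :: "complex mat \<Rightarrow> real" where
  "lambda_max A = Max {r :: real. eigenvalue A (complex_of_real r)}"

definition local_maximizer_on :: "real set \<Rightarrow> (real \<Rightarrow> real) \<Rightarrow> real \<Rightarrow> bool" where
  "local_maximizer_on D f x \<longleftrightarrow> x \<in> D \<and> (\<forall>\<^sub>F t in at x within D. f t \<le> f x)"

(* Intended for open U, where the derivatives only depend on the values of f on U. *)
definition C2_on :: "real set \<Rightarrow> (real \<Rightarrow> real) \<Rightarrow> bool" where
  "C2_on U f \<longleftrightarrow>
     (\<forall>t\<in>U. f differentiable at t) \<and>
     (\<forall>t\<in>U. deriv f differentiable at t) \<and>
     continuous_on U (deriv (deriv f))"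

end

theory Submission
  imports Defs "HOL-Complex_Analysis.Complex_Analysis"
begin

hide_const (open) Module.smult Coset.order

text \<open>The characteristic polynomial of H(t) extends to a family p(t) of polynomials with coefficients
  holomorphic near the given point (taken to be t = 0), and it is real-rooted for real t. Starting from the
  largest root c of p(0), of multiplicity m, one follows the largest root of p(t), t > 0, by a
  Newton--Puiseux recursion. The simple root of the (m - 1)-st derivative of p(t) near c is analytic in t;
  recentring there removes the coefficient of degree m - 1. Real-rootedness then forces the cluster of
  m roots to have integral slope k: after the substitution X = t^k Z the family is again analytic, and
  its limit at t = 0 has only roots of multiplicity less than m. This yields an analytic branch that is a root
  of p(t) for t on both sides of 0 and the largest root for t > 0; reflecting t gives the branch for t < 0.

  At a local maximizer of the largest eigenvalue f both branches lie below f and agree with it at 0, so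
  both have vanishing first derivative there. Their second derivatives agree as well, since otherwise one
  branch would exceed the other on both sides of 0. Gluing two analytic functions with equal 2-jets gives
  a function that is C^2 with Lipschitz second derivative.\<close>

section \<open>Real-rooted polynomials\<close>

text \<open>The hypothesis of a local maximum is essential: for the diagonal family with entries t
  and -t the larger eigenvalue is |t|, with a corner. At a maximizer branches may still separate at
  third order: entries -t^2 + t^3 and -t^2 - t^3 give -t^2 + |t|^3, so a Lipschitz second derivative
  cannot be improved to C^3. The recursion follows one side of 0 because X = t^k Z preserves the
  order of real roots only for t > 0; for odd k it is reversed when t < 0. The substitution also
  drives the roots outside the cluster to infinity. For t > 0 these lie below c and go to minus
  infinity, which does not disturb the largest root. Still, each branch has to be a root on both
  sides: lying below f on both sides of 0 is what passes the maximum of f on to the branch, and it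
  also lets a branch be compared with f on the side where f is given by the other one.\<close>

definition real_rooted :: "complex poly \<Rightarrow> bool" where
  "real_rooted q \<longleftrightarrow> (\<forall>z. poly q z = 0 \<longrightarrow> z \<in> \<real>)"

lemma real_rooted_nonzero: "real_rooted q \<Longrightarrow> q \<noteq> 0"
  by (auto simp: real_rooted_def complex_is_Real_iff dest: spec[of _ \<i>])

lemma real_rooted_imp_linear_factors:
  assumes "real_rooted q"
  obtains A where "size A = degree q" "\<And>x. x \<in># A \<Longrightarrow> x \<in> \<real>"
    "q = smult (lead_coeff q) (\<Prod>x\<in>#A. [:-x, 1:])"
proof -
  obtain A where A: "size A = degree q" "q = smult (lead_coeff q) (\<Prod>x\<in>#A. [:-x, 1:])"
    using alg_closed_imp_factorization real_rooted_nonzero[OF assms] by blast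
  moreover have "x \<in> \<real>" if "x \<in># A" for x
  proof -
    have "poly (\<Prod>x\<in>#A. [:-x, 1:]) x = 0"
      using that by (auto simp: poly_prod_mset prod_mset_zero_iff image_iff intro!: bexI[of _ x])
    hence "poly q x = 0" by (subst A(2)) simp
    thus ?thesis using assms by (auto simp: real_rooted_def)
  qed
  ultimately show ?thesis using that by blast
qed

text \<open>Off the real axis p'/p is a sum of terms 1/(z - x), whose imaginary parts all have the sign
  opposite to that of Im z.\<close>

lemma Im_log_derivative_neg:
  fixes A :: "complex multiset"
  assumes "\<And>x. x \<in># A \<Longrightarrow> x \<in> \<real>" "z \<notin> \<real>" "A \<noteq> {#}"
  defines "p \<equiv> (\<Prod>x\<in>#A. [:-x, 1:])"
  shows "Im (poly (pderiv p) z / poly p z) * Im z < 0"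
proof -
  have nz: "poly (\<Prod>x\<in>#B. [:-x, 1:]) z \<noteq> 0" if "\<And>x. x \<in># B \<Longrightarrow> x \<in> \<real>" for B
    using that assms(2) by (auto simp: poly_prod_mset prod_mset_zero_iff)
  have step: "Im (1 / (z - x)) * Im z < 0" if "x \<in> \<real>" for x
  proof -
    have "Im z \<noteq> 0" "Im x = 0" using assms(2) that by (auto simp: complex_is_Real_iff)
    hence "Im (1 / (z - x)) * Im z = - ((Im z)\<^sup>2 / ((Re (z - x))\<^sup>2 + (Im z)\<^sup>2))"
      by (simp add: Im_divide power2_eq_square)
    also have "\<dots> < 0" using \<open>Im z \<noteq> 0\<close> by (simp add: sum_power2_gt_zero_iff add_nonneg_pos)
    finally show ?thesis .
  qed
  \<comment> \<open>The weak inequality is carried along because it also covers the empty product;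
    it is what the remaining factors contribute next to one strictly signed term.\<close>
  have "Im (poly (pderiv (\<Prod>x\<in>#B. [:-x, 1:])) z / poly (\<Prod>x\<in>#B. [:-x, 1:]) z) * Im z \<le> 0 \<and>
     (B \<noteq> {#} \<longrightarrow> Im (poly (pderiv (\<Prod>x\<in>#B. [:-x, 1:])) z / poly (\<Prod>x\<in>#B. [:-x, 1:]) z) * Im z < 0)"
    if "\<And>x. x \<in># B \<Longrightarrow> x \<in> \<real>" for B
    using that
  proof (induction B)
    case empty
    then show ?case by (simp add: pderiv_1)
  next
    case (add x B)
    define r where "r = (\<Prod>x\<in>#B. [:-x, 1:])"
    have r: "poly r z \<noteq> 0" unfolding r_def using add.prems by (intro nz) auto
    have zx: "z - x \<noteq> 0" using add.prems assms(2) by auto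
    have "poly (pderiv ([:-x, 1:] * r)) z / poly ([:-x, 1:] * r) z
       = 1 / (z - x) + poly (pderiv r) z / poly r z"
    proof -
      have "pderiv ([:-x, 1:] * r) = [:-x, 1:] * pderiv r + r"
        by (subst pderiv_mult) (simp add: pderiv_pCons)
      hence "poly (pderiv ([:-x, 1:] * r)) z = (z - x) * poly (pderiv r) z + poly r z"
        by (simp only: poly_add poly_mult) simp
      moreover have "poly ([:-x, 1:] * r) z = (z - x) * poly r z"
        by (simp only: poly_mult) simp
      moreover have "((z - x) * d + v) / ((z - x) * v) = 1 / (z - x) + d / v" if "v \<noteq> 0" for d v
        using that zx by (simp add: add_divide_distrib)
      ultimately show ?thesis using r by (simp only:)
    qed
    moreover have "Im (1 / (z - x)) * Im z < 0" using add.prems by (intro step) auto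
    moreover have "Im (poly (pderiv r) z / poly r z) * Im z \<le> 0"
      unfolding r_def using add by auto
    ultimately show ?case
      unfolding image_mset_add_mset prod_mset.add_mset r_def[symmetric]
      by (auto simp only: plus_complex.sel distrib_right intro: add_neg_nonpos less_imp_le)
  qed
  thus ?thesis using assms by blast
qed

text \<open>At a non-real z the quotient q'/q has nonzero imaginary part, so q' cannot vanish there.
  A constant has derivative zero, and the zero polynomial is not real-rooted.\<close>

lemma real_rooted_pderiv:
  assumes "real_rooted q" "degree q > 0"
  shows "real_rooted (pderiv q)"
  unfolding real_rooted_def
proof (intro allI impI, rule ccontr)
  fix z assume z: "poly (pderiv q) z = 0" "z \<notin> \<real>"
  obtain A where A: "size A = degree q" "\<And>x. x \<in># A \<Longrightarrow> x \<in> \<real>"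
    "q = smult (lead_coeff q) (\<Prod>x\<in>#A. [:-x, 1:])"
    using real_rooted_imp_linear_factors[OF assms(1)] by blast
  have "A \<noteq> {#}" using A(1) assms(2) by auto
  moreover have "poly (pderiv (\<Prod>x\<in>#A. [:-x, 1:])) z = 0"
    using z(1) real_rooted_nonzero[OF assms(1)] by (subst (asm) A(3)) (simp add: pderiv_smult)
  ultimately show False using Im_log_derivative_neg[of A z] A(2) z(2) by auto
qed

lemma real_rooted_higher_pderiv:
  assumes "real_rooted q" "k \<le> degree q"
  shows "real_rooted ((pderiv ^^ k) q)"
  using assms(2)
  by (induction k) (use assms(1) in \<open>auto intro!: real_rooted_pderiv simp: degree_higher_pderiv\<close>)

section \<open>Reciprocal roots and coefficient bounds\<close>

lemma real_rooted_reflect: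
  assumes "real_rooted q" shows "real_rooted (reflect_poly q)"
  unfolding real_rooted_def
proof (intro allI impI)
  fix z assume z: "poly (reflect_poly q) z = 0"
  show "z \<in> \<real>"
  proof (cases "z = 0")
    case False
    hence "poly q (inverse z) = 0" using z by (simp add: poly_reflect_poly_nz)
    hence "inverse z \<in> \<real>" using assms by (auto simp: real_rooted_def)
    thus ?thesis using Reals_inverse[of "inverse z"] by simp
  qed simp
qed

text \<open>Reciprocal roots normalize by the constant coefficient, so that the low coefficients
  become, up to sign, elementary symmetric functions of real numbers.\<close>

lemma real_rooted_imp_inverse_factors:
  assumes "real_rooted q" "coeff q 0 \<noteq> 0"
  obtains A :: "real multiset" where "size A = degree q"
    "q = smult (coeff q 0) (\<Prod>y\<in>#A. [:1, - complex_of_real y:])"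
proof -
  obtain A where A: "size A = degree q" "\<And>x. x \<in># A \<Longrightarrow> x \<in> \<real>"
    "q = smult (lead_coeff q) (\<Prod>x\<in>#A. [:-x, 1:])"
    using real_rooted_imp_linear_factors[OF assms(1)] by blast
  have nz: "x \<noteq> 0" if "x \<in># A" for x
  proof
    assume "x = 0"
    hence "poly (\<Prod>x\<in>#A. [:-x, 1:]) 0 = 0"
      using that by (auto simp: poly_prod_mset prod_mset_zero_iff image_iff intro!: bexI[of _ x])
    hence "poly q 0 = 0" by (subst A(3)) simp
    thus False using assms(2) by (simp add: poly_0_coeff_0)
  qed
  define B where "B = image_mset (\<lambda>x. Re (1 / x)) A"
  \<comment> \<open>Each factor \<open>[:-x, 1:]\<close> is \<open>-x\<close> times
    \<open>[:1, -1/x:]\<close>. The accumulated scalar is not computed here; comparing constant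
    coefficients identifies it afterwards.\<close>
  have "\<exists>c. (\<Prod>x\<in>#A'. [:-x, 1:]) = smult c (\<Prod>y\<in>#image_mset (\<lambda>x. Re (1 / x)) A'. [:1, - complex_of_real y:])"
    if "A' \<subseteq># A" for A' using that
  proof (induction A')
    case empty
    show ?case by (auto intro: exI[of _ 1])
  next
    case (add x A')
    have xA: "x \<in># A" using add.prems by (auto dest: mset_subset_eqD)
    obtain c where c: "(\<Prod>x\<in>#A'. [:-x, 1:]) = smult c (\<Prod>y\<in>#image_mset (\<lambda>x. Re (1 / x)) A'. [:1, - complex_of_real y:])"
      using add by (meson subset_mset.dual_order.trans mset_subset_eq_add_mset_cancel mset_subset_eq_insertD subset_mset.less_imp_le)
    have "complex_of_real (Re (1 / x)) = 1 / x"
      by (intro of_real_Re Reals_divide) (use A(2)[OF xA] in auto)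
    hence "[:-x, 1:] = smult (-x) [:1, - complex_of_real (Re (1 / x)):]"
      using nz[OF xA] by simp
    hence "(\<Prod>x\<in>#add_mset x A'. [:-x, 1:]) = smult (-x * c)
        (\<Prod>y\<in>#image_mset (\<lambda>x. Re (1 / x)) (add_mset x A'). [:1, - complex_of_real y:])"
      unfolding image_mset_add_mset prod_mset.add_mset c by (simp only: mult_smult_left mult_smult_right smult_smult mult.commute[of c])
    thus ?case by blast
  qed
  from this[of A] obtain c where c: "(\<Prod>x\<in>#A. [:-x, 1:]) = smult c (\<Prod>y\<in>#B. [:1, - complex_of_real y:])"
    unfolding B_def by blast
  define d where "d = lead_coeff q * c"
  have d: "q = smult d (\<Prod>y\<in>#B. [:1, - complex_of_real y:])"
    by (subst A(3)) (simp add: c d_def)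
  have "poly (\<Prod>y\<in>#B. [:1, - complex_of_real y:]) 0 = 1"
    by (simp add: poly_prod_mset)
  hence "coeff (\<Prod>y\<in>#B. [:1, - complex_of_real y:]) 0 = 1"
    by (simp only: poly_0_coeff_0)
  moreover have "coeff q 0 = d * coeff (\<Prod>y\<in>#B. [:1, - complex_of_real y:]) 0"
    by (subst d) (rule coeff_smult)
  ultimately have "coeff q 0 = d" by simp
  hence "q = smult (coeff q 0) (\<Prod>y\<in>#B. [:1, - complex_of_real y:])" using d by (simp only:)
  moreover have "size B = degree q" using A(1) by (simp add: B_def)
  ultimately show ?thesis using that by blast
qed

text \<open>The last equation is Newton's identity 2 e_2 = p_1^2 - p_2, kept free of
  division.\<close>

lemma coeff_prod_inverse_factors:
  fixes A :: "real multiset"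
  defines "p \<equiv> (\<lambda>A. \<Prod>y\<in>#A. [:1, - complex_of_real y:])"
  shows "coeff (p A) 0 = 1" "coeff (p A) 1 = - of_real (\<Sum>y\<in>#A. y)"
    "2 * coeff (p A) 2 = of_real ((\<Sum>y\<in>#A. y)\<^sup>2 - (\<Sum>y\<in>#A. y\<^sup>2))"
proof -
  have "coeff (p A) 0 = 1 \<and> coeff (p A) 1 = - of_real (\<Sum>y\<in>#A. y) \<and>
    2 * coeff (p A) 2 = of_real ((\<Sum>y\<in>#A. y)\<^sup>2 - (\<Sum>y\<in>#A. y\<^sup>2))"
  proof (induction A)
    case (add y A)
    define S1 S2 where "S1 = (\<Sum>y\<in>#A. y)" and "S2 = (\<Sum>y\<in>#A. y\<^sup>2)"
    have "p (add_mset y A) = p A + smult (- of_real y) (pCons 0 (p A))"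
      by (simp add: p_def)
    hence c: "coeff (p (add_mset y A)) 0 = coeff (p A) 0"
      "coeff (p (add_mset y A)) 1 = coeff (p A) 1 - of_real y * coeff (p A) 0"
      "coeff (p (add_mset y A)) 2 = coeff (p A) 2 - of_real y * coeff (p A) 1"
      by (simp_all add: numeral_2_eq_2)
    have IH: "coeff (p A) 0 = 1" "coeff (p A) 1 = - of_real S1"
      "2 * coeff (p A) 2 = of_real (S1\<^sup>2 - S2)"
      using add unfolding S1_def S2_def by blast+
    have S: "(\<Sum>y\<in>#add_mset y A. y) = y + S1" "(\<Sum>y\<in>#add_mset y A. y\<^sup>2) = y\<^sup>2 + S2"
      unfolding S1_def S2_def by simp_all
    have "2 * coeff (p (add_mset y A)) 2 = 2 * coeff (p A) 2 + 2 * of_real y * of_real S1"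
      unfolding c(3) IH(2) by (simp add: algebra_simps)
    also have "\<dots> = of_real ((y + S1)\<^sup>2 - (y\<^sup>2 + S2))"
      unfolding IH(3) by (simp add: power2_eq_square algebra_simps)
    finally show ?case unfolding S using c(1,2) IH(1,2) by simp
  qed (auto simp: p_def coeff_1)
  thus "coeff (p A) 0 = 1" "coeff (p A) 1 = - of_real (\<Sum>y\<in>#A. y)"
    "2 * coeff (p A) 2 = of_real ((\<Sum>y\<in>#A. y)\<^sup>2 - (\<Sum>y\<in>#A. y\<^sup>2))" by auto
qed

text \<open>Up to sign, coefficient i is a sum of at most \<open>2 ^ size A\<close> products of i of
  the numbers.\<close>

lemma norm_coeff_prod_inverse_factors_le:
  fixes A :: "real multiset"
  assumes "\<And>y. y \<in># A \<Longrightarrow> \<bar>y\<bar> \<le> B" "B \<ge> 0"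
  shows "norm (coeff (\<Prod>y\<in>#A. [:1, - complex_of_real y:]) i) \<le> 2 ^ size A * B ^ i"
  using assms(1)
proof (induction A arbitrary: i)
  case empty
  show ?case using assms(2) by (auto simp: coeff_1)
next
  case (add y A)
  define p where "p = (\<Prod>y\<in>#A. [:1, - complex_of_real y:])"
  have eq: "(\<Prod>y\<in>#add_mset y A. [:1, - complex_of_real y:]) = p + smult (- of_real y) (pCons 0 p)"
    by (simp add: p_def)
  have IH: "norm (coeff p j) \<le> 2 ^ size A * B ^ j" for j
    unfolding p_def using add by auto
  have y: "\<bar>y\<bar> \<le> B" using add.prems by auto
  show ?case
  proof (cases i)
    case 0
    show ?thesis unfolding eq using IH[of 0] 0 order.trans[OF IH[of 0], of "2 * 2 ^ size A"] by simp
  next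
    case (Suc j)
    have "norm (coeff p i - of_real y * coeff p j) \<le> norm (coeff p i) + \<bar>y\<bar> * norm (coeff p j)"
      by (metis norm_triangle_ineq4 norm_mult norm_of_real real_norm_def)
    also have "\<dots> \<le> 2 ^ size A * B ^ i + B * (2 ^ size A * B ^ j)"
      using y IH by (intro add_mono mult_mono) (use assms(2) in auto)
    finally show ?thesis unfolding eq using Suc by (simp add: algebra_simps)
  qed
qed

lemma abs_le_of_sum_squares_mset:
  fixes A :: "real multiset"
  assumes "(\<Sum>y\<in>#A. y\<^sup>2) \<le> B\<^sup>2" "B \<ge> 0" "y \<in># A"
  shows "\<bar>y\<bar> \<le> B"
proof -
  have nn: "(\<Sum>y\<in>#A'. y\<^sup>2) \<ge> 0" for A' :: "real multiset" by (induction A') auto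
  obtain A' where "A = add_mset y A'" using assms(3) by (metis insert_DiffM)
  hence "y\<^sup>2 \<le> B\<^sup>2" using nn[of A'] assms(1) by auto
  thus ?thesis using assms(2) by (metis abs_le_square_iff abs_of_nonneg)
qed

text \<open>The vanishing linear coefficient says that the reciprocal roots sum to 0, so the
  normalized quadratic one is minus half the sum of their squares. That one number bounds every
  reciprocal root, and with them all coefficients.\<close>

lemma real_rooted_coeff_bounds_low:
  assumes "real_rooted q" "coeff q 0 \<noteq> 0" "coeff q 1 = 0"
  shows "coeff q 2 / coeff q 0 \<in> \<real>" "Re (coeff q 2 / coeff q 0) \<le> 0"
    "\<And>B i. B \<ge> 0 \<Longrightarrow> 2 * norm (coeff q 2 / coeff q 0) \<le> B\<^sup>2 \<Longrightarrow>
      norm (coeff q i / coeff q 0) \<le> 2 ^ degree q * B ^ i"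
proof -
  obtain A :: "real multiset" where A: "size A = degree q"
    "q = smult (coeff q 0) (\<Prod>y\<in>#A. [:1, - complex_of_real y:])"
    using real_rooted_imp_inverse_factors[OF assms(1,2)] by blast
  define p where "p = (\<Prod>y\<in>#A. [:1, - complex_of_real y:])"
  have c: "coeff q i / coeff q 0 = coeff p i" for i
    using assms(2) by (subst A(2)) (simp add: p_def coeff_prod_inverse_factors(1))
  have "coeff p 1 = 0" using c[of 1] assms(3) by simp
  hence "- complex_of_real (\<Sum>y\<in>#A. y) = 0"
    unfolding p_def coeff_prod_inverse_factors(2) .
  hence "(\<Sum>y\<in>#A. y) = 0" by (simp only: neg_equal_0_iff_equal of_real_eq_0_iff)
  hence "2 * coeff p 2 = of_real (- (\<Sum>y\<in>#A. y\<^sup>2))"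
    using coeff_prod_inverse_factors(3)[of A] by (simp add: p_def)
  hence p2: "coeff p 2 = of_real (- (\<Sum>y\<in>#A. y\<^sup>2) / 2)" by (simp add: field_simps)
  have nn: "(\<Sum>y\<in>#A'. y\<^sup>2) \<ge> 0" for A' :: "real multiset" by (induction A') auto
  show "coeff q 2 / coeff q 0 \<in> \<real>" unfolding c p2 by (rule Reals_of_real)
  show "Re (coeff q 2 / coeff q 0) \<le> 0" unfolding c p2 Re_complex_of_real using nn[of A] by simp
  show "norm (coeff q i / coeff q 0) \<le> 2 ^ degree q * B ^ i"
    if B: "B \<ge> 0" "2 * norm (coeff q 2 / coeff q 0) \<le> B\<^sup>2" for B i
  proof -
    have "(\<Sum>y\<in>#A. y\<^sup>2) \<le> B\<^sup>2" using B(2) nn[of A] unfolding c p2 norm_of_real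
      by (simp only: abs_minus_cancel abs_divide minus_divide_left[symmetric])
    thus ?thesis unfolding c p_def A(1)[symmetric]
      by (intro norm_coeff_prod_inverse_factors_le abs_le_of_sum_squares_mset[of A B] B(1))
  qed
qed

text \<open>Reversing the coefficients and differentiating reduces to a real-rooted polynomial
  in which the coefficients above index m no longer occur.\<close>

lemma real_rooted_coeff_bounds:
  assumes q: "real_rooted q" "coeff q m \<noteq> 0" "coeff q (m - 1) = 0" and m: "m \<ge> 2"
    and n: "degree q \<le> n"
  shows "coeff q (m - 2) / coeff q m \<in> \<real>" "Re (coeff q (m - 2) / coeff q m) \<le> 0"
    "\<And>s i. s \<ge> 0 \<Longrightarrow> norm (coeff q (m - 2) / coeff q m) \<le> s\<^sup>2 \<Longrightarrow> i \<le> m \<Longrightarrow>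
      norm (coeff q (m - i) / coeff q m) \<le> 2 ^ n * (real n * s) ^ i"
proof -
  define N where "N = degree q"
  have mN: "m \<le> N" unfolding N_def using q(2) le_degree by blast
  define D where "D = (pderiv ^^ (N - m)) (reflect_poly q)"
  have coeffD: "coeff D i = pochhammer (of_nat (Suc i)) (N - m) * coeff q (m - i)" if "i \<le> m" for i
  proof -
    have "N - (i + (N - m)) = m - i" "i + (N - m) \<le> N" using that mN by auto
    thus ?thesis unfolding D_def coeff_higher_pderiv coeff_reflect_poly N_def[symmetric] by simp
  qed
  \<comment> \<open>Differentiating weights coefficient i by (N - m)! times this binomial. As
    \<open>w 0 = 1\<close> and all weights are at least 1, going back from ratios for
    \<open>D\<close> to ratios for \<open>q\<close> only makes them smaller.\<close>
  define w where "w = (\<lambda>i. of_nat ((N - m + i) choose i) :: real)"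
  have poch: "pochhammer (of_nat (Suc i)) (N - m) = (fact (N - m) * of_real (w i) :: complex)" for i
  proof -
    have "(fact (N - m) * of_nat ((N - m + i) choose i) :: complex)
       = fact (N - m + i) / fact i"
      by (subst binomial_fact) auto
    also have "\<dots> = pochhammer (of_nat (Suc i)) (N - m)"
      proof -
      have "fact (N - m + i) = fact i * (pochhammer (1 + of_nat i) (N - m) :: complex)"
        using pochhammer_product'[of "1::complex" i "N - m"]
        by (simp only: pochhammer_fact[symmetric] add.commute[of "N - m" i])
      thus ?thesis by simp
    qed
    finally show ?thesis by (simp add: w_def)
  qed
  have w1: "w i \<ge> 1" for i
  proof -
    have "1 \<le> ((N - m + i) choose i)" by (simp add: Suc_le_eq)
    thus ?thesis unfolding w_def by linarith
  qed
  have w0: "w 0 = 1" by (simp add: w_def)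
  have D0: "coeff D 0 = fact (N - m) * coeff q m"
    using coeffD[of 0] poch[of 0] w0 by simp
  have D0nz: "coeff D 0 \<noteq> 0" using D0 q(2) by simp
  have D1: "coeff D 1 = 0" using coeffD[of 1] m q(3) by simp
  have ratio: "coeff D i / coeff D 0 = of_real (w i) * (coeff q (m - i) / coeff q m)" if "i \<le> m" for i
    using coeffD[OF that] poch[of i] D0 by simp
  \<comment> \<open>Reflection lowers the degree if 0 is a root of \<open>q\<close>; this nonzero
    coefficient shows that N - m derivatives are still admissible.\<close>
  have deg_refl: "coeff (reflect_poly q) (N - m) \<noteq> 0"
    using q(2) mN by (simp add: coeff_reflect_poly N_def[symmetric])
  have rr: "real_rooted D" unfolding D_def
    by (intro real_rooted_higher_pderiv real_rooted_reflect q(1) le_degree deg_refl)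
  have degD: "degree D \<le> n"
    using degree_reflect_poly_le[of q] n unfolding D_def degree_higher_pderiv by linarith
  note low = real_rooted_coeff_bounds_low[OF rr D0nz D1]
  have r2: "coeff q (m - 2) / coeff q m = (coeff D 2 / coeff D 0) * of_real (1 / w 2)"
    using ratio[OF m] w1[of 2] by simp
  show "coeff q (m - 2) / coeff q m \<in> \<real>" unfolding r2 by (intro Reals_mult low(1) Reals_of_real)
  show "Re (coeff q (m - 2) / coeff q m) \<le> 0" unfolding r2
    using mult_nonpos_nonneg[OF low(2), of "1 / w 2"] w1[of 2]
    by (simp only: times_complex.sel Re_complex_of_real Im_complex_of_real) simp
  show "norm (coeff q (m - i) / coeff q m) \<le> 2 ^ n * (real n * s) ^ i"
    if s: "s \<ge> 0" "norm (coeff q (m - 2) / coeff q m) \<le> s\<^sup>2" "i \<le> m" for s i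
  proof -
    \<comment> \<open>Since m >= 2, both N - m + 2 and N - m + 1 are at most n. The factor
      \<open>real n\<close> in the bound is there to absorb the weight \<open>w 2\<close>.\<close>
    have "2 * ((N - m + 2) choose 2) \<le> n * n"
    proof -
      have "2 * ((N - m + 2) choose 2) \<le> (N - m + 2) * (N - m + 1)"
        by (simp add: choose_two)
      also have "\<dots> \<le> n * n" using mN m n unfolding N_def by (intro mult_mono) auto
      finally show ?thesis .
    qed
    hence "2 * w 2 \<le> real n ^ 2"
      unfolding w_def power2_eq_square by (metis of_nat_le_iff of_nat_mult of_nat_numeral)
    have "2 * norm (coeff D 2 / coeff D 0) = 2 * w 2 * norm (coeff q (m - 2) / coeff q m)"
      unfolding ratio[OF m] norm_mult using w1[of 2] by simp
    also have "\<dots> \<le> real n ^ 2 * s\<^sup>2"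
      using s \<open>2 * w 2 \<le> real n ^ 2\<close> by (intro mult_mono) auto
    finally have "2 * norm (coeff D 2 / coeff D 0) \<le> (real n * s)\<^sup>2"
      by (simp add: power_mult_distrib)
    hence *: "norm (coeff D i / coeff D 0) \<le> 2 ^ degree D * (real n * s) ^ i"
      using s(1) by (intro low(3)) auto
    have "norm (coeff q (m - i) / coeff q m) \<le> w i * norm (coeff q (m - i) / coeff q m)"
      using mult_right_mono[OF w1[of i], of "norm (coeff q (m - i) / coeff q m)"] by simp
    also have "\<dots> = norm (coeff D i / coeff D 0)"
      unfolding ratio[OF s(3)] norm_mult using w1[of i] by simp
    also have "\<dots> \<le> 2 ^ degree D * (real n * s) ^ i" by (rule *)
    also have "\<dots> \<le> 2 ^ n * (real n * s) ^ i"
      using degD s(1) by (intro mult_right_mono power_increasing) auto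
    finally show ?thesis .
  qed
qed


section \<open>Analytic families of polynomials\<close>

text \<open>The degree bound is uniform but need not be attained: the degree may drop at t = 0, as
  it can after rescaling. Uniformity turns every evaluation into one finite sum with analytic
  coefficients.\<close>

definition poly_family :: "(complex \<Rightarrow> complex poly) \<Rightarrow> bool" where
  "poly_family p \<longleftrightarrow> (\<exists>n. \<forall>t. degree (p t) \<le> n) \<and> (\<forall>j. (\<lambda>t. coeff (p t) j) analytic_on {0})"

lemma poly_familyI:
  assumes "\<And>t. degree (p t) \<le> n" "\<And>j. (\<lambda>t. coeff (p t) j) analytic_on {0}"
  shows "poly_family p"
  using assms by (auto simp: poly_family_def)

lemma poly_family_coeff: "poly_family p \<Longrightarrow> (\<lambda>t. coeff (p t) j) analytic_on {0}"
  by (auto simp: poly_family_def)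

lemma poly_family_degree:
  assumes "poly_family p" obtains n where "\<And>t. degree (p t) \<le> n"
  using assms by (auto simp: poly_family_def)

lemma poly_family_const: "poly_family (\<lambda>_. q)"
  by (rule poly_familyI[of _ "degree q"]) auto

lemma poly_family_add:
  assumes "poly_family p" "poly_family q" shows "poly_family (\<lambda>t. p t + q t)"
proof -
  obtain m n where "\<And>t. degree (p t) \<le> m" "\<And>t. degree (q t) \<le> n"
    using poly_family_degree assms by metis
  hence "degree (p t + q t) \<le> max m n" for t by (intro degree_add_le) (auto simp: le_max_iff_disj)
  thus ?thesis using assms by (intro poly_familyI[of _ "max m n"])
    (auto intro!: analytic_intros poly_family_coeff)
qed

lemma poly_family_mult:
  assumes "poly_family p" "poly_family q" shows "poly_family (\<lambda>t. p t * q t)"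
proof -
  obtain m n where "\<And>t. degree (p t) \<le> m" "\<And>t. degree (q t) \<le> n"
    using poly_family_degree assms by metis
  hence "degree (p t * q t) \<le> m + n" for t using degree_mult_le[of "p t" "q t"] add_mono le_trans by blast
  thus ?thesis using assms by (intro poly_familyI[of _ "m + n"])
    (auto simp: coeff_mult intro!: analytic_intros poly_family_coeff)
qed

lemma poly_family_sum: "(\<And>i. i \<in> I \<Longrightarrow> poly_family (p i)) \<Longrightarrow> poly_family (\<lambda>t. \<Sum>i\<in>I. p i t)"
  by (induction I rule: infinite_finite_induct) (auto intro: poly_family_const poly_family_add)

lemma poly_family_prod: "(\<And>i. i \<in> I \<Longrightarrow> poly_family (p i)) \<Longrightarrow> poly_family (\<lambda>t. \<Prod>i\<in>I. p i t)"
  by (induction I rule: infinite_finite_induct) (auto intro: poly_family_const poly_family_mult)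

lemma poly_family_power: "poly_family p \<Longrightarrow> poly_family (\<lambda>t. p t ^ k)"
  by (induction k) (auto intro: poly_family_const poly_family_mult)

lemma poly_family_monom: "a analytic_on {0} \<Longrightarrow> poly_family (\<lambda>t. monom (a t) i)"
proof (rule poly_familyI[of _ i])
  show "(\<lambda>t. coeff (monom (a t) i) j) analytic_on {0}" if "a analytic_on {0}" for j
    using that by (cases "i = j") auto
qed (auto simp: degree_monom_le)

lemma poly_family_linear: "a analytic_on {0} \<Longrightarrow> b analytic_on {0} \<Longrightarrow> poly_family (\<lambda>t. [:a t, b t:])"
  using poly_family_add[OF poly_family_monom[of a 0] poly_family_monom[of b 1]]
  by (simp add: monom_0 monom_Suc)

lemma poly_family_smult: "a analytic_on {0} \<Longrightarrow> poly_family p \<Longrightarrow> poly_family (\<lambda>t. smult (a t) (p t))"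
  using poly_family_mult[OF poly_family_monom[of a 0], of p] by (simp add: monom_0)

lemma poly_family_higher_pderiv:
  assumes "poly_family p" shows "poly_family (\<lambda>t. (pderiv ^^ k) (p t))"
proof -
  obtain n where n: "\<And>t. degree (p t) \<le> n" using poly_family_degree assms by blast
  show ?thesis
  proof (rule poly_familyI[of _ n])
    show "degree ((pderiv ^^ k) (p t)) \<le> n" for t
      using n[of t] by (simp add: degree_higher_pderiv)
    show "(\<lambda>t. coeff ((pderiv ^^ k) (p t)) j) analytic_on {0}" for j
      unfolding coeff_higher_pderiv by (intro analytic_intros poly_family_coeff assms)
  qed
qed

lemma poly_eq_sum_le:
  fixes p :: "'a::comm_semiring_1 poly"
  assumes "degree p \<le> n" shows "poly p x = (\<Sum>i\<le>n. coeff p i * x ^ i)"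
  by (subst poly_as_sum_of_monoms'[OF assms, symmetric]) (simp add: poly_sum poly_monom)

lemma poly_family_pcompose:
  assumes "poly_family p" "poly_family q" shows "poly_family (\<lambda>t. pcompose (p t) (q t))"
proof -
  obtain n where n: "\<And>t. degree (p t) \<le> n" using poly_family_degree assms by blast
  have "pcompose (p t) (q t) = (\<Sum>i\<le>n. smult (coeff (p t) i) (q t ^ i))" for t
    by (rule poly_ext)
       (simp add: poly_pcompose poly_eq_sum_le[OF n] poly_sum)
  thus ?thesis
    by (simp only:) (intro poly_family_sum poly_family_smult poly_family_power poly_family_coeff assms)
qed

lemma poly_family_uminus:
  assumes "poly_family p" shows "poly_family (\<lambda>t. p (- t))"
proof -
  obtain n where n: "\<And>t. degree (p t) \<le> n" using poly_family_degree assms by blast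
  have "((\<lambda>t. coeff (p t) j) \<circ> uminus) analytic_on {0}" for j
    by (rule analytic_on_compose_gen[of _ _ _ "{0}"])
      (auto intro!: analytic_intros poly_family_coeff assms)
  thus ?thesis using n by (intro poly_familyI[of _ n]) (auto simp: o_def)
qed

lemma poly_family_tendsto:
  assumes "poly_family p" "(f \<longlongrightarrow> 0) F" "(g \<longlongrightarrow> c) F"
  shows "((\<lambda>x. poly (p (f x)) (g x)) \<longlongrightarrow> poly (p 0) c) F"
proof -
  obtain n where n: "\<And>t. degree (p t) \<le> n" using poly_family_degree assms by blast
  have "((\<lambda>x. coeff (p (f x)) i) \<longlongrightarrow> coeff (p 0) i) F" for i
    using isCont_tendsto_compose[OF analytic_at_imp_isCont[OF poly_family_coeff[OF assms(1)]] assms(2)] .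
  thus ?thesis unfolding poly_eq_sum_le[OF n] by (intro tendsto_intros assms(3))
qed

lemma poly_family_holomorphic:
  assumes "poly_family p"
  obtains d where "d > 0" "\<And>j. (\<lambda>t. coeff (p t) j) holomorphic_on ball 0 d"
proof -
  obtain n where n: "\<And>t. degree (p t) \<le> n" using poly_family_degree assms by blast
  have "\<exists>d>0. (\<lambda>t. coeff (p t) j) holomorphic_on ball 0 d" for j
    using poly_family_coeff[OF assms] by (auto simp: analytic_at_ball)
  then obtain d where d: "\<And>j. d j > 0" "\<And>j. (\<lambda>t. coeff (p t) j) holomorphic_on ball 0 (d j)"
    by metis
  define e where "e = Min (d ` {..n})"
  have "e > 0" unfolding e_def using d(1) by (subst Min_gr_iff) auto
  moreover have "(\<lambda>t. coeff (p t) j) holomorphic_on ball 0 e" for j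
  proof (cases "j \<le> n")
    case True
    hence "e \<le> d j" unfolding e_def by (intro Min_le) auto
    thus ?thesis using d(2) by (meson holomorphic_on_subset subset_ball)
  next
    case False
    hence "coeff (p t) j = 0" for t using n[of t] by (intro coeff_eq_0) auto
    thus ?thesis by simp
  qed
  ultimately show ?thesis using that by blast
qed

text \<open>A polynomial without roots near c is nearly constant there up to a bounded factor. Hence a root of
  p 0 at c forces roots of p t near c; otherwise p t, being small at c, would tend to 0 on a whole ball.\<close>

lemma norm_poly_le_far_roots:
  fixes q :: "complex poly"
  assumes "q \<noteq> 0" "\<And>z. poly q z = 0 \<Longrightarrow> e \<le> dist z c" "norm w \<le> e"
  shows "norm (poly q (c + w)) \<le> 2 ^ degree q * norm (poly q c)"
proof -
  obtain A where A: "size A = degree q" "q = smult (lead_coeff q) (\<Prod>x\<in>#A. [:-x, 1:])"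
    using alg_closed_imp_factorization[OF assms(1)] by blast
  have far: "e \<le> dist x c" if "x \<in># A" for x
  proof (rule assms(2))
    have "poly (\<Prod>x\<in>#A. [:-x, 1:]) x = 0"
      using that by (auto simp: poly_prod_mset prod_mset_zero_iff image_iff intro!: bexI[of _ x])
    thus "poly q x = 0" by (subst A(2)) simp
  qed
  have "norm (poly (\<Prod>x\<in>#A. [:-x, 1:]) (c + w)) \<le> 2 ^ size A * norm (poly (\<Prod>x\<in>#A. [:-x, 1:]) c)"
    using far
  proof (induction A)
    case (add x A)
    define r where "r = (\<Prod>x\<in>#A. [:-x, 1:])"
    have "norm (c + w - x) \<le> norm (c - x) + norm w"
      by (metis add_diff_eq add.commute norm_triangle_ineq diff_add_eq)
    also have "norm w \<le> norm (c - x)"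
      using add.prems[of x] assms(3) by (simp add: dist_norm norm_minus_commute)
    finally have "norm (c + w - x) \<le> 2 * norm (c - x)" by simp
    moreover have "norm (poly r (c + w)) \<le> 2 ^ size A * norm (poly r c)"
      unfolding r_def by (rule add.IH) (use add.prems in auto)
    ultimately have "norm (c + w - x) * norm (poly r (c + w)) \<le> (2 * norm (c - x)) * (2 ^ size A * norm (poly r c))"
      by (intro mult_mono) auto
    moreover have "poly (\<Prod>x\<in>#add_mset x A. [:-x, 1:]) z = (z - x) * poly r z" for z
      by (simp add: r_def algebra_simps)
    ultimately show ?case by (simp only: norm_mult) (simp add: mult_ac)
  qed auto
  hence "norm (lead_coeff q) * norm (poly (\<Prod>x\<in>#A. [:-x, 1:]) (c + w))
      \<le> norm (lead_coeff q) * (2 ^ size A * norm (poly (\<Prod>x\<in>#A. [:-x, 1:]) c))"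
    by (intro mult_left_mono) auto
  moreover have "norm (poly q z) = norm (lead_coeff q) * norm (poly (\<Prod>x\<in>#A. [:-x, 1:]) z)" for z
    by (subst A(2)) (simp add: norm_mult)
  ultimately show ?thesis unfolding A(1) by (simp add: mult_ac)
qed

lemma poly_family_root_near:
  assumes p: "poly_family p" and "p 0 \<noteq> 0" "poly (p 0) c = 0" "e > 0"
  shows "\<forall>\<^sub>F t in nhds 0. \<exists>z. dist z c < e \<and> poly (p t) z = 0"
proof -
  obtain n where n: "\<And>t. degree (p t) \<le> n" using poly_family_degree p by blast
  \<comment> \<open>Supplies a point of the ball at which \<open>p 0\<close> does not vanish; there
    |p t| stays above \<eta>/2, while the bound coming from c tends to 0.\<close>
  have "infinite (ball c e)"
    using assms(4) by (metis finite_imp_not_open open_ball centre_in_ball empty_iff)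
  hence "\<not> ball c e \<subseteq> {z. poly (p 0) z = 0}"
    using poly_roots_finite[OF assms(2)] finite_subset by blast
  then obtain z where z: "z \<in> ball c e" "poly (p 0) z \<noteq> 0" by blast
  define \<eta> where "\<eta> = norm (poly (p 0) z)"
  have \<eta>: "\<eta> > 0" using z by (simp add: \<eta>_def)
  have "((\<lambda>t. norm (poly (p t) z)) \<longlongrightarrow> \<eta>) (nhds 0)" unfolding \<eta>_def
    by (intro tendsto_norm poly_family_tendsto[OF p] tendsto_ident_at tendsto_const filterlim_ident)
  hence 1: "\<forall>\<^sub>F t in nhds 0. norm (poly (p t) z) > \<eta> / 2"
    using \<eta> by (intro order_tendstoD) auto
  have "((\<lambda>t. 2 ^ n * norm (poly (p t) c)) \<longlongrightarrow> 2 ^ n * norm (poly (p 0) c)) (nhds 0)"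
    by (intro tendsto_intros poly_family_tendsto[OF p] filterlim_ident)
  hence 2: "\<forall>\<^sub>F t in nhds 0. 2 ^ n * norm (poly (p t) c) < \<eta> / 2"
    using \<eta> assms(3) by (intro order_tendstoD(2)[of _ "2 ^ n * norm (poly (p 0) c)"]) auto
  show ?thesis using 1 2
  proof eventually_elim
    case (elim t)
    show ?case
    proof (rule ccontr)
      assume *: "\<not> (\<exists>z. dist z c < e \<and> poly (p t) z = 0)"
      have "p t \<noteq> 0" using elim(1) \<eta> by auto
      hence "norm (poly (p t) (c + (z - c))) \<le> 2 ^ degree (p t) * norm (poly (p t) c)"
      proof (rule norm_poly_le_far_roots)
        show "e \<le> dist x c" if "poly (p t) x = 0" for x using * that by force
        show "norm (z - c) \<le> e" using z(1) by (simp add: dist_norm norm_minus_commute)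
      qed
      also have "\<dots> \<le> 2 ^ n * norm (poly (p t) c)"
        by (intro mult_right_mono power_increasing n) auto
      finally show False using elim by simp
    qed
  qed
qed

section \<open>Analytic dependence of a simple root\<close>

text \<open>The quotient (p x - p y)/(x - y) in polynomial form, so that it makes sense on the
  diagonal and is jointly continuous in the coefficients, x and y. It takes the place of the
  implicit function theorem.\<close>

definition divided_difference :: "'a::comm_ring_1 poly \<Rightarrow> 'a \<Rightarrow> 'a \<Rightarrow> 'a" where
  "divided_difference p x y = (\<Sum>j\<le>degree p. coeff p j * (\<Sum>i<j. x ^ i * y ^ (j - Suc i)))"

lemma divided_difference_eq_sum_le:
  "degree p \<le> n \<Longrightarrow> divided_difference p x y = (\<Sum>j\<le>n. coeff p j * (\<Sum>i<j. x ^ i * y ^ (j - Suc i)))"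
  unfolding divided_difference_def
  by (rule sum.mono_neutral_left) (auto simp: coeff_eq_0)

lemma divided_difference: "poly p x - poly p y = (x - y) * divided_difference p x y"
proof -
  have "x ^ j - y ^ j = (x - y) * (\<Sum>i<j. x ^ i * y ^ (j - Suc i))" for j
    by (simp add: power_diff_sumr2 mult.commute)
  thus ?thesis
    by (simp add: poly_altdef divided_difference_def flip: sum_subtractf right_diff_distrib)
       (simp add: sum_distrib_left mult_ac)
qed

lemma divided_difference_diag: "divided_difference p x x = poly (pderiv p) x"
proof -
  have "poly (pderiv p) x = (\<Sum>j\<le>degree p. coeff p j * (of_nat j * x ^ (j - 1)))"
  proof -
    have "pderiv p = pderiv (\<Sum>j\<le>degree p. monom (coeff p j) j)"
      by (simp only: poly_as_sum_of_monoms)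
    also have "\<dots> = (\<Sum>j\<le>degree p. pderiv (monom (coeff p j) j))"
      by (rule pderiv_sum)
    finally show ?thesis by (simp add: poly_sum pderiv_monom poly_monom mult_ac)
  qed
  moreover have "(\<Sum>i<j. x ^ i * x ^ (j - Suc i)) = of_nat j * x ^ (j - 1)" for j
  proof -
    have "(\<Sum>i<j. x ^ i * x ^ (j - Suc i)) = (\<Sum>i<j. x ^ (j - 1))"
      by (intro sum.cong refl) (simp flip: power_add)
    thus ?thesis by simp
  qed
  ultimately show ?thesis by (simp add: divided_difference_def)
qed

text \<open>Simplicity makes the divided difference nonzero at (0, c, c), hence bounded away from 0
  nearby. Solving its defining identity for the increment of the root gives uniqueness, continuity
  and complex differentiability.\<close>

lemma poly_family_simple_root:
  assumes p: "poly_family p" and "poly (p 0) c = 0" "poly (pderiv (p 0)) c \<noteq> 0"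
  obtains \<gamma> where "\<gamma> analytic_on {0}" "\<gamma> 0 = c" "\<forall>\<^sub>F t in nhds 0. poly (p t) (\<gamma> t) = 0"
proof -
  obtain n where n: "\<And>t. degree (p t) \<le> n" using poly_family_degree p by blast
  obtain d0 where d0: "d0 > 0" "\<And>j. (\<lambda>t. coeff (p t) j) holomorphic_on ball 0 d0"
    using poly_family_holomorphic[OF p] by blast
  have cont_coeff: "((\<lambda>x. coeff (p (f x)) j) \<longlongrightarrow> coeff (p s) j) F"
    if "s \<in> ball 0 d0" "(f \<longlongrightarrow> s) F" for f s F j
  proof -
    have "isCont (\<lambda>t. coeff (p t) j) s"
      using holomorphic_on_imp_continuous_on[OF d0(2)[of j]] that(1)
      by (simp only: continuous_on_eq_continuous_at[OF open_ball])
    thus ?thesis using that(2) by (rule isCont_tendsto_compose)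
  qed
  have G_lim: "((\<lambda>u. divided_difference (p (f u)) (g u) (h u)) \<longlongrightarrow> divided_difference (p s) x y) F"
    if "s \<in> ball 0 d0" "(f \<longlongrightarrow> s) F" "(g \<longlongrightarrow> x) F" "(h \<longlongrightarrow> y) F" for f g h s x y F
    unfolding divided_difference_eq_sum_le[OF n] by (intro tendsto_intros cont_coeff that)
  define a where "a = norm (poly (pderiv (p 0)) c)"
  have a: "a > 0" using assms(3) by (simp add: a_def)
  have id: "((\<lambda>u. u) \<longlongrightarrow> (0, c, c)) (nhds (0 :: complex, c, c))" by (rule filterlim_ident)
  have "((\<lambda>u. norm (divided_difference (p (fst u)) (fst (snd u)) (snd (snd u)))) \<longlongrightarrow> a) (nhds (0, c, c))"
    unfolding a_def divided_difference_diag[symmetric]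
  proof (intro tendsto_norm G_lim)
    show "(0::complex) \<in> ball 0 d0" using d0 by simp
    show "(fst \<longlongrightarrow> 0) (nhds (0 :: complex, c, c))" using tendsto_fst[OF id] by simp
    show "((\<lambda>u. fst (snd u)) \<longlongrightarrow> c) (nhds (0 :: complex, c, c))"
      using tendsto_fst[OF tendsto_snd[OF id]] by simp
    show "((\<lambda>u. snd (snd u)) \<longlongrightarrow> c) (nhds (0 :: complex, c, c))"
      using tendsto_snd[OF tendsto_snd[OF id]] by simp
  qed
  hence "\<forall>\<^sub>F u in nhds (0, c, c). norm (divided_difference (p (fst u)) (fst (snd u)) (snd (snd u))) > a / 2"
    using a by (intro order_tendstoD) auto
  then obtain S where "open S" "(0, c, c) \<in> S" and
    S: "\<And>u. u \<in> S \<Longrightarrow> norm (divided_difference (p (fst u)) (fst (snd u)) (snd (snd u))) > a / 2"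
    unfolding eventually_nhds by blast
  obtain T U where TU: "open T" "open U" "(0, c, c) \<in> T \<times> U" "T \<times> U \<subseteq> S"
    by (rule open_prod_elim[OF \<open>open S\<close> \<open>(0, c, c) \<in> S\<close>])
  hence "(c, c) \<in> U" by simp
  obtain V W where V: "open V" "open W" "(c, c) \<in> V \<times> W" "V \<times> W \<subseteq> U"
    by (rule open_prod_elim[OF \<open>open U\<close> \<open>(c, c) \<in> U\<close>])
  have "open (V \<inter> W)" "c \<in> V \<inter> W" using V by auto
  then obtain e where e: "e > 0" "ball c e \<subseteq> V \<inter> W"
    by (rule openE) blast
  have "\<forall>\<^sub>F t in nhds 0. t \<in> T \<and> t \<in> ball 0 d0 \<and> (\<exists>z. dist z c < e \<and> poly (p t) z = 0)"
  proof (intro eventually_conj poly_family_root_near p assms e(1))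
    show "p 0 \<noteq> 0" using assms(3) by auto
    show "\<forall>\<^sub>F t in nhds 0. t \<in> ball 0 d0"
      using d0(1) by (intro eventually_nhds_in_open) auto
  qed (use TU d0 in \<open>auto intro!: eventually_nhds_in_open\<close>)
  then obtain d where d: "d > 0" "\<And>t. t \<in> ball 0 d \<Longrightarrow> t \<in> T \<and> t \<in> ball 0 d0 \<and> (\<exists>z. dist z c < e \<and> poly (p t) z = 0)"
    unfolding eventually_nhds_metric by (metis mem_ball dist_commute)
  have G: "norm (divided_difference (p t) x y) > a / 2" if "t \<in> ball 0 d" "dist x c < e" "dist y c < e" for t x y
  proof -
    have "x \<in> ball c e" "y \<in> ball c e" using that by (auto simp: dist_commute)
    hence "(x, y) \<in> U" using e(2) V(4) by blast
    hence "(t, x, y) \<in> S" using d(2)[OF that(1)] TU(4) by blast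
    from S[OF this] show ?thesis by simp
  qed
  \<comment> \<open>The choice is unambiguous near 0: by \<open>G\<close>, two distinct roots of
    \<open>p t\<close> cannot both lie within e of c.\<close>
  define \<gamma> where "\<gamma> = (\<lambda>t. SOME z. dist z c < e \<and> poly (p t) z = 0)"
  have \<gamma>: "dist (\<gamma> t) c < e" "poly (p t) (\<gamma> t) = 0" if "t \<in> ball 0 d" for t
  proof -
    have "dist (\<gamma> t) c < e \<and> poly (p t) (\<gamma> t) = 0"
      unfolding \<gamma>_def by (rule someI_ex) (use d(2)[OF that] in blast)
    thus "dist (\<gamma> t) c < e" "poly (p t) (\<gamma> t) = 0" by blast+
  qed
  have diff: "\<gamma> t - \<gamma> s = - poly (p t) (\<gamma> s) / divided_difference (p t) (\<gamma> t) (\<gamma> s)"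
    if "t \<in> ball 0 d" "s \<in> ball 0 d" for s t
  proof -
    have "divided_difference (p t) (\<gamma> t) (\<gamma> s) \<noteq> 0"
      using G[OF that(1) \<gamma>(1)[OF that(1)] \<gamma>(1)[OF that(2)]] a by auto
    thus ?thesis using divided_difference[of "p t" "\<gamma> t" "\<gamma> s"] \<gamma>(2)[OF that(1)]
      by (simp add: eq_divide_eq)
  qed
  have cont: "(\<gamma> \<longlongrightarrow> \<gamma> s) (at s)" if s: "s \<in> ball 0 d" for s
  proof -
    have "((\<lambda>t. poly (p t) (\<gamma> s)) \<longlongrightarrow> poly (p s) (\<gamma> s)) (at s)"
      unfolding poly_eq_sum_le[OF n] by (intro tendsto_intros cont_coeff) (use d(2)[OF s] in auto)
    hence "((\<lambda>t. norm (poly (p t) (\<gamma> s)) / (a / 2)) \<longlongrightarrow> 0) (at s)"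
      using tendsto_divide_zero[OF tendsto_norm_zero, of "\<lambda>t. poly (p t) (\<gamma> s)" "at s" "a / 2"] \<gamma>(2)[OF s] by simp
    moreover have "\<forall>\<^sub>F t in at s. norm (\<gamma> t - \<gamma> s) \<le> norm (poly (p t) (\<gamma> s)) / (a / 2)"
    proof -
      have "\<forall>\<^sub>F t in at s. t \<in> ball 0 d" using s by (intro eventually_at_in_open') auto
      thus ?thesis
      proof eventually_elim
        case (elim t)
        show ?case unfolding diff[OF elim s] norm_divide norm_minus_cancel
          using G[OF elim \<gamma>(1)[OF elim] \<gamma>(1)[OF s]] a by (intro divide_left_mono mult_pos_pos) auto
      qed
    qed
    ultimately have "((\<lambda>t. \<gamma> t - \<gamma> s) \<longlongrightarrow> 0) (at s)" by (rule Lim_null_comparison[rotated])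
    thus ?thesis by (simp add: LIM_zero_iff)
  qed
  have "\<gamma> field_differentiable (at s)" if s: "s \<in> ball 0 d" for s
  proof -
    have "(\<lambda>t. poly (p t) (\<gamma> s)) holomorphic_on ball 0 d0"
      unfolding poly_eq_sum_le[OF n] by (intro holomorphic_intros d0)
    then obtain D where "((\<lambda>t. poly (p t) (\<gamma> s)) has_field_derivative D) (at s)"
      using holomorphic_on_imp_differentiable_at[OF _ open_ball, of _ 0 d0 s] d(2)[OF s]
      unfolding field_differentiable_def by blast
    hence "((\<lambda>t. (poly (p t) (\<gamma> s) - poly (p s) (\<gamma> s)) / (t - s)) \<longlongrightarrow> D) (at s)"
      by (simp add: has_field_derivative_iff)
    moreover have "((\<lambda>t. divided_difference (p t) (\<gamma> t) (\<gamma> s)) \<longlongrightarrow> divided_difference (p s) (\<gamma> s) (\<gamma> s)) (at s)"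
      by (intro G_lim cont s tendsto_intros) (use d(2)[OF s] in auto)
    moreover have "divided_difference (p s) (\<gamma> s) (\<gamma> s) \<noteq> 0"
      using G[OF s \<gamma>(1)[OF s] \<gamma>(1)[OF s]] a by auto
    ultimately have "((\<lambda>t. - ((poly (p t) (\<gamma> s) - poly (p s) (\<gamma> s)) / (t - s)) / divided_difference (p t) (\<gamma> t) (\<gamma> s))
        \<longlongrightarrow> - D / divided_difference (p s) (\<gamma> s) (\<gamma> s)) (at s)"
      by (intro tendsto_intros)
    moreover have "\<forall>\<^sub>F t in at s. - ((poly (p t) (\<gamma> s) - poly (p s) (\<gamma> s)) / (t - s)) / divided_difference (p t) (\<gamma> t) (\<gamma> s)
        = (\<gamma> t - \<gamma> s) / (t - s)"
    proof -
      have "\<forall>\<^sub>F t in at s. t \<in> ball 0 d" using s by (intro eventually_at_in_open') auto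
      thus ?thesis
        by eventually_elim (simp only: diff[OF _ s] \<gamma>(2)[OF s] diff_zero, simp)
    qed
    ultimately have "((\<lambda>t. (\<gamma> t - \<gamma> s) / (t - s)) \<longlongrightarrow> - D / divided_difference (p s) (\<gamma> s) (\<gamma> s)) (at s)"
      by (rule Lim_transform_eventually)
    thus ?thesis by (auto simp: field_differentiable_def has_field_derivative_iff)
  qed
  hence "\<gamma> holomorphic_on ball 0 d" by (auto simp: holomorphic_on_def intro: field_differentiable_at_within)
  hence "\<gamma> analytic_on {0}" using d(1) by (auto simp: analytic_at_ball)
  moreover have "\<gamma> 0 = c"
  proof -
    have "0 \<in> ball (0::complex) d" using d by simp
    hence "\<gamma> 0 = c \<or> divided_difference (p 0) (\<gamma> 0) c = 0" "norm (divided_difference (p 0) (\<gamma> 0) c) > a / 2"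
      using divided_difference[of "p 0" "\<gamma> 0" c] \<gamma>[of 0] G[of 0 "\<gamma> 0" c] e(1) assms(2) by simp_all
    thus ?thesis using a by auto
  qed
  moreover have "\<forall>\<^sub>F t in nhds 0. poly (p t) (\<gamma> t) = 0"
  proof (rule eventually_mono)
    show "\<forall>\<^sub>F t in nhds 0. t \<in> ball (0::complex) d"
      using d(1) by (intro eventually_nhds_in_open) auto
  qed (rule \<gamma>(2))
  ultimately show ?thesis using that by blast
qed

section \<open>Orders of vanishing, read off the real axis\<close>

lemma tendsto_of_real_at_0: "(complex_of_real \<longlongrightarrow> 0) (at 0 within S)"
  using tendsto_of_real[OF tendsto_ident_at, of 0 S] by simp

lemma eventually_of_real_nhds:
  "\<forall>\<^sub>F t in nhds (0::complex). P t \<Longrightarrow> \<forall>\<^sub>F t in at (0::real) within S. P (complex_of_real t)"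
  by (rule eventually_compose_filterlim[OF _ tendsto_of_real_at_0])

lemma eventually_at_imp_at_within:
  "eventually P (at x) \<Longrightarrow> eventually P (at x within S)"
  by (rule filter_leD[OF at_le]) auto

lemma analytic_at_0_factor:
  assumes "a analytic_on {0}"
  shows "(\<forall>\<^sub>F t in nhds 0. a t = 0) \<or>
    (\<exists>N u. u analytic_on {0} \<and> u 0 \<noteq> 0 \<and> (\<forall>\<^sub>F t in nhds (0::complex). a t = t ^ N * u t))"
proof -
  obtain e where e: "e > 0" "a holomorphic_on ball 0 e" using assms by (auto simp: analytic_at_ball)
  have ball: "\<forall>\<^sub>F t in nhds (0::complex). t \<in> ball 0 r" if "r > 0" for r
    using that by (intro eventually_nhds_in_open) auto
  consider "a 0 \<noteq> 0" | "a 0 = 0" "a constant_on ball 0 e" | "a 0 = 0" "\<not> a constant_on ball 0 e" by blast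
  thus ?thesis
  proof cases
    case 1
    hence "a analytic_on {0} \<and> a 0 \<noteq> 0 \<and> (\<forall>\<^sub>F t in nhds 0. a t = t ^ 0 * a t)" using assms by simp
    thus ?thesis by blast
  next
    case 2
    then obtain y where y: "\<And>t. t \<in> ball 0 e \<Longrightarrow> a t = y" unfolding constant_on_def by blast
    have "a t = 0" if "t \<in> ball 0 e" for t
      using y[OF that] y[of 0] 2(1) e(1) by simp
    thus ?thesis using ball[OF e(1)] by (intro disjI1) (rule eventually_mono)
  next
    case 3
    have 0: "0 \<in> ball (0::complex) e" using e(1) by simp
    have "\<exists>g r N. 0 < r \<and> g holomorphic_on ball 0 r \<and>
      (\<forall>w\<in>ball 0 r. a w = w ^ N * g w) \<and> (\<forall>w\<in>ball 0 r. g w \<noteq> 0)"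
    proof (rule holomorphic_factor_zero_nonconstant[OF e(2) open_ball connected_ball 0 3])
      fix g :: "complex \<Rightarrow> complex" and r N
      assume *: "0 < r" "g holomorphic_on ball 0 r"
        "\<And>w. w \<in> ball 0 r \<Longrightarrow> a w = (w - 0) ^ N * g w" "\<And>w. w \<in> ball 0 r \<Longrightarrow> g w \<noteq> 0"
      show ?thesis by (rule exI[of _ g], rule exI[of _ r], rule exI[of _ N]) (use * in simp)
    qed
    then obtain g r N where g: "0 < r" "g holomorphic_on ball 0 r"
      "\<And>w. w \<in> ball 0 r \<Longrightarrow> a w = w ^ N * g w" "\<And>w. w \<in> ball 0 r \<Longrightarrow> g w \<noteq> 0" by blast
    have "g analytic_on {0}" unfolding analytic_at_ball using g(1,2) by blast
    moreover have "g 0 \<noteq> 0" using g(1,4) by simp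
    moreover have "\<forall>\<^sub>F t in nhds 0. a t = t ^ N * g t"
      by (rule eventually_mono[OF ball[OF g(1)]]) (use g(3) in simp)
    ultimately show ?thesis by blast
  qed
qed

lemma analytic_at_0_tendsto:
  "a analytic_on {0} \<Longrightarrow> ((\<lambda>t. a (complex_of_real t)) \<longlongrightarrow> a 0) (at 0 within S)"
  by (rule isCont_tendsto_compose[OF analytic_at_imp_isCont tendsto_of_real_at_0])

lemma analytic_at_0_bounded:
  assumes "a analytic_on {0}"
  obtains B where "B > 0" "\<forall>\<^sub>F t in nhds 0. norm (a t) \<le> B"
proof -
  have "(a \<longlongrightarrow> a 0) (nhds 0)"
    by (rule isCont_tendsto_compose[OF analytic_at_imp_isCont[OF assms] filterlim_ident])
  hence "((\<lambda>t. norm (a t)) \<longlongrightarrow> norm (a 0)) (nhds 0)" by (rule tendsto_norm)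
  hence "\<forall>\<^sub>F t in nhds 0. norm (a t) < norm (a 0) + 1" by (rule order_tendstoD) simp
  hence "\<forall>\<^sub>F t in nhds 0. norm (a t) \<le> norm (a 0) + 1" by (rule eventually_mono) simp
  thus ?thesis using that[of "norm (a 0) + 1"] by (simp add: add_nonneg_pos)
qed

text \<open>A bound on the real axis controls the order at 0: were the order \<open>N\<close> below
  \<open>K\<close>, dividing the bound by \<open>t ^ N\<close> would force
  \<open>u 0 = 0\<close>.\<close>

lemma analytic_at_0_divide_power:
  assumes a: "a analytic_on {0}"
    and bound: "\<forall>\<^sub>F t in at (0::real). norm (a (complex_of_real t)) \<le> C * \<bar>t\<bar> ^ K"
  shows "\<exists>d. d analytic_on {0} \<and> (\<forall>\<^sub>F t in nhds 0. a t = t ^ K * d t)"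
  using analytic_at_0_factor[OF a]
proof (elim disjE exE conjE)
  assume "\<forall>\<^sub>F t in nhds 0. a t = 0"
  thus ?thesis by (intro exI[of _ "\<lambda>_. 0"]) auto
next
  fix N u assume u: "u analytic_on {0}" "u 0 \<noteq> 0" "\<forall>\<^sub>F t in nhds 0. a t = t ^ N * u t"
  have "K \<le> N"
  proof (rule ccontr)
    assume "\<not> K \<le> N"
    hence KN: "K = N + (K - N)" "K - N > 0" by auto
    have "\<forall>\<^sub>F t in at (0::real). norm (u (complex_of_real t)) \<le> C * \<bar>t\<bar> ^ (K - N)"
      using bound eventually_of_real_nhds[OF u(3)] eventually_neq_at_within[of 0 0 UNIV]
    proof eventually_elim
      case (elim t)
      have "\<bar>t\<bar> ^ K = \<bar>t\<bar> ^ N * \<bar>t\<bar> ^ (K - N)" using KN(1) by (metis power_add)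
      hence "\<bar>t\<bar> ^ N * norm (u t) \<le> \<bar>t\<bar> ^ N * (C * \<bar>t\<bar> ^ (K - N))"
        using elim(1,2) by (simp add: norm_mult norm_power mult.left_commute)
      thus ?case using elim(3) by (simp add: mult_le_cancel_left_pos)
    qed
    moreover have "((\<lambda>t. norm (u (complex_of_real t))) \<longlongrightarrow> norm (u 0)) (at 0)"
      by (intro tendsto_norm analytic_at_0_tendsto u)
    moreover have "((\<lambda>t. C * \<bar>t\<bar> ^ (K - N)) \<longlongrightarrow> C * \<bar>0\<bar> ^ (K - N)) (at (0::real))"
      by (intro tendsto_intros)
    ultimately have "norm (u 0) \<le> C * \<bar>0\<bar> ^ (K - N)"
      by (intro tendsto_le[of "at (0::real)"]) auto
    thus False using u(2) KN(2) by (simp add: power_0_left)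
  qed
  have "(\<lambda>t. t ^ (N - K) * u t) analytic_on {0}" by (intro analytic_intros u)
  moreover have "\<forall>\<^sub>F t in nhds 0. a t = t ^ K * (t ^ (N - K) * u t)"
    using u(3)
  proof eventually_elim
    case (elim t)
    have "t ^ N = t ^ K * t ^ (N - K)" using \<open>K \<le> N\<close> by (simp flip: power_add)
    thus ?case using elim by simp
  qed
  ultimately show ?thesis by blast
qed

text \<open>For odd \<open>N\<close> the sign of \<open>t ^ N\<close> flips at 0, so the limits of
  Re u from the two sides have opposite weak signs. As Im u is 0 on the punctured axis,
  \<open>u 0\<close> would vanish.\<close>

lemma even_order_of_nonpos:
  assumes u: "u analytic_on {0}" "u 0 \<noteq> 0"
    and sgn: "\<forall>\<^sub>F t in at (0::real). complex_of_real t ^ N * u t \<in> \<real> \<and> Re (complex_of_real t ^ N * u t) \<le> 0"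
  shows "even N"
proof (rule ccontr)
  assume odd: "odd N"
  have sgn': "\<forall>\<^sub>F t in at (0::real). Im (u t) = 0 \<and> t ^ N * Re (u t) \<le> 0"
    using sgn eventually_neq_at_within[of 0 0 UNIV]
  proof eventually_elim
    case (elim t)
    have "Re (complex_of_real t ^ N * u t) = t ^ N * Re (u t)" "Im (complex_of_real t ^ N * u t) = t ^ N * Im (u t)"
      unfolding of_real_power[symmetric] by simp_all
    thus ?case using elim by (simp add: complex_is_Real_iff)
  qed
  have lim: "((\<lambda>t. Re (u (complex_of_real t))) \<longlongrightarrow> Re (u 0)) (at 0 within S)"
     "((\<lambda>t. Im (u (complex_of_real t))) \<longlongrightarrow> Im (u 0)) (at 0 within S)" for S
    by (intro tendsto_intros analytic_at_0_tendsto u)+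
  have "\<forall>\<^sub>F t in at_right (0::real). Re (u t) \<le> 0"
    using eventually_at_imp_at_within[OF sgn'] eventually_at_right_less[of 0]
  proof eventually_elim
    case (elim t)
    have "t ^ N > 0" using elim(2) by simp
    thus ?case using elim(1) by (simp add: mult_le_0_iff)
  qed
  hence "Re (u 0) \<le> 0" by (intro tendsto_upperbound[OF lim(1)]) auto
  moreover have "\<forall>\<^sub>F t in at_left (0::real). t < 0" by (simp add: eventually_at_filter)
  with eventually_at_imp_at_within[OF sgn', of "{..<0}"]
  have "\<forall>\<^sub>F t in at_left (0::real). 0 \<le> Re (u t)"
  proof eventually_elim
    case (elim t)
    have "t ^ N < 0" using elim(2) odd by (simp add: power_less_zero_eq)
    hence "\<not> Re (u t) < 0" using mult_neg_neg[of "t ^ N" "Re (u t)"] elim(1) by linarith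
    thus ?case by simp
  qed
  hence "0 \<le> Re (u 0)" by (intro tendsto_lowerbound[OF lim(1)]) auto
  moreover have "Im (u 0) = 0"
  proof (rule tendsto_unique[OF _ lim(2)])
    show "((\<lambda>t. Im (u (complex_of_real t))) \<longlongrightarrow> 0) (at 0 within UNIV)"
      by (rule tendsto_eventually) (use sgn' in \<open>rule eventually_mono, simp\<close>)
  qed auto
  ultimately show False using u(2) by (auto simp: complex_eq_iff)
qed

section \<open>Taylor coefficients at a shifted centre\<close>

lemma higher_pderiv_offset:
  "(pderiv ^^ j) (pcompose p [:c, 1:]) = pcompose ((pderiv ^^ j) p) [:c, 1:]"
  by (induction j) (simp_all add: pderiv_pcompose pderiv_pCons)

lemma coeff_offset:
  fixes p :: "'a::field_char_0 poly"
  shows "coeff (pcompose p [:c, 1:]) j = poly ((pderiv ^^ j) p) c / fact j"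
proof -
  have "coeff ((pderiv ^^ j) (pcompose p [:c, 1:])) 0 = poly ((pderiv ^^ j) p) c"
    unfolding higher_pderiv_offset by simp
  thus ?thesis unfolding coeff_higher_pderiv by (simp add: pochhammer_fact[symmetric] field_simps)
qed

lemma coeff_offset_order:
  fixes p :: "'a::field_char_0 poly"
  assumes "p \<noteq> 0"
  shows "j < order c p \<Longrightarrow> coeff (pcompose p [:c, 1:]) j = 0"
    and "coeff (pcompose p [:c, 1:]) (order c p) \<noteq> 0"
proof -
  obtain q where q: "p = [:- c, 1:] ^ order c p * q" "\<not> [:- c, 1:] dvd q"
    using order_decomp[OF assms] by blast
  have pow: "pcompose (a ^ k) b = pcompose a b ^ k" for a b :: "'a poly" and k
    by (induction k) (simp_all add: pcompose_mult pcompose_1)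
  have "pcompose p [:c, 1:] = (pcompose [:- c, 1:] [:c, 1:]) ^ order c p * pcompose q [:c, 1:]"
    by (subst q(1)) (simp only: pcompose_mult pow)
  also have "pcompose [:- c, 1:] [:c, 1:] = monom 1 1"
    by (simp add: pcompose_pCons monom_Suc monom_0)
  finally have eq: "pcompose p [:c, 1:] = monom 1 (order c p) * pcompose q [:c, 1:]"
    by (simp add: monom_power)
  show "j < order c p \<Longrightarrow> coeff (pcompose p [:c, 1:]) j = 0"
    unfolding eq by (simp add: coeff_monom_mult)
  show "coeff (pcompose p [:c, 1:]) (order c p) \<noteq> 0"
    unfolding eq using q(2) by (simp add: coeff_monom_mult dvd_iff_poly_eq_0)
qed

text \<open>Separates the \<open>m\<close> coefficients that control a cluster at 0 from a cofactor
  that is nonzero near 0 when coefficient \<open>m\<close> is nonzero.\<close>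

lemma poly_eq_shift:
  fixes p :: "'a::comm_ring_1 poly"
  shows "poly p x = (\<Sum>j<m. coeff p j * x ^ j) + x ^ m * poly (poly_shift m p) x"
proof -
  have "p = (\<Sum>j<m. monom (coeff p j) j) + monom 1 m * poly_shift m p"
    by (rule poly_eqI) (auto simp: coeff_sum coeff_monom_mult coeff_poly_shift coeff_monom)
  thus ?thesis by (metis (mono_tags, lifting) poly_add poly_sum poly_monom poly_mult mult_1 sum.cong)
qed

lemma poly_family_shift:
  assumes "poly_family p" shows "poly_family (\<lambda>t. poly_shift m (p t))"
proof -
  obtain n where n: "\<And>t. degree (p t) \<le> n" using poly_family_degree assms by blast
  show ?thesis
  proof (rule poly_familyI[of _ n])
    show "degree (poly_shift m (p t)) \<le> n" for t
      using n[of t] by (intro degree_le) (auto simp: coeff_poly_shift coeff_eq_0)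
    show "(\<lambda>t. coeff (poly_shift m (p t)) j) analytic_on {0}" for j
      unfolding coeff_poly_shift by (intro poly_family_coeff assms)
  qed
qed

section \<open>Limits of values and roots at t = 0\<close>

lemma poly_family_uniform:
  assumes "poly_family p" "\<eta> > 0"
  shows "\<forall>\<^sub>F t in nhds 0. \<forall>z. norm z \<le> R \<longrightarrow> norm (poly (p t) z - poly (p 0) z) < \<eta>"
proof -
  obtain n where n: "\<And>t. degree (p t) \<le> n" using poly_family_degree assms by blast
  have c: "((\<lambda>t. coeff (p t) i) \<longlongrightarrow> coeff (p 0) i) (nhds 0)" for i
    by (rule isCont_tendsto_compose[OF analytic_at_imp_isCont[OF poly_family_coeff[OF assms(1)]] filterlim_ident])
  have "((\<lambda>t. \<Sum>i\<le>n. norm (coeff (p t) i - coeff (p 0) i) * R ^ i) \<longlongrightarrow>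
     (\<Sum>i\<le>n. norm (coeff (p 0) i - coeff (p 0) i) * R ^ i)) (nhds 0)"
    by (intro tendsto_intros c)
  hence "\<forall>\<^sub>F t in nhds 0. (\<Sum>i\<le>n. norm (coeff (p t) i - coeff (p 0) i) * R ^ i) < \<eta>"
    using assms(2) by (intro order_tendstoD(2)) auto
  thus ?thesis
  proof eventually_elim
    case (elim t)
    show ?case
    proof (intro allI impI)
      fix z :: complex assume z: "norm z \<le> R"
      have "norm (poly (p t) z - poly (p 0) z) = norm (\<Sum>i\<le>n. (coeff (p t) i - coeff (p 0) i) * z ^ i)"
        unfolding poly_eq_sum_le[OF n] by (simp add: sum_subtractf left_diff_distrib)
      also have "\<dots> \<le> (\<Sum>i\<le>n. norm (coeff (p t) i - coeff (p 0) i) * R ^ i)"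
        by (intro sum_norm_le) (auto simp: norm_mult norm_power z intro!: mult_left_mono power_mono)
      finally show "norm (poly (p t) z - poly (p 0) z) < \<eta>" using elim by simp
    qed
  qed
qed

lemma poly_family_nonzero_near:
  assumes p: "poly_family p" and "poly (p 0) c \<noteq> 0"
  obtains e \<alpha> where "e > 0" "\<alpha> > 0"
    "\<forall>\<^sub>F t in nhds 0. \<forall>z. dist z c < e \<longrightarrow> \<alpha> \<le> norm (poly (p t) z)"
proof -
  \<comment> \<open>One third, because passing from c to z and from parameter 0 to t each costs less
    than \<alpha>.\<close>
  define \<alpha> where "\<alpha> = norm (poly (p 0) c) / 3"
  have \<alpha>: "\<alpha> > 0" using assms by (simp add: \<alpha>_def)
  have "isCont (poly (p 0)) c" by simp
  then obtain e where e: "e > 0" "\<And>z. dist z c < e \<Longrightarrow> dist (poly (p 0) z) (poly (p 0) c) < \<alpha>"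
    using \<alpha> unfolding continuous_at_eps_delta by blast
  have "\<forall>\<^sub>F t in nhds 0. \<forall>z. dist z c < e \<longrightarrow> \<alpha> \<le> norm (poly (p t) z)"
    using poly_family_uniform[OF p \<alpha>, of "norm c + e"]
  proof eventually_elim
    case (elim t)
    show ?case
    proof (intro allI impI)
      fix z assume z: "dist z c < e"
      have "norm z \<le> norm c + e" using z norm_triangle_ineq2[of z c] by (simp add: dist_norm)
      hence "norm (poly (p t) z - poly (p 0) z) < \<alpha>" using elim by blast
      moreover have "norm (poly (p 0) z - poly (p 0) c) < \<alpha>" using e(2)[OF z] by (simp add: dist_norm)
      moreover have "norm (poly (p 0) c) \<le> norm (poly (p t) z) + norm (poly (p t) z - poly (p 0) z) + norm (poly (p 0) z - poly (p 0) c)"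
        using norm_triangle_ineq4[of "poly (p t) z" "poly (p t) z - poly (p 0) z"]
          norm_triangle_ineq4[of "poly (p 0) z" "poly (p 0) z - poly (p 0) c"] by simp
      ultimately show "\<alpha> \<le> norm (poly (p t) z)" by (simp add: \<alpha>_def)
    qed
  qed
  thus ?thesis using that e(1) \<alpha> by blast
qed

text \<open>A non-real root of the limit attracts roots of \<open>p t\<close> to within less than
  its distance from the real axis, so these would be non-real too.\<close>

lemma real_rooted_limit:
  assumes "poly_family p" "\<forall>\<^sub>F t in at (0::real). real_rooted (p t)" "p 0 \<noteq> 0"
  shows "real_rooted (p 0)"
  unfolding real_rooted_def
proof (intro allI impI, rule ccontr)
  fix z assume z: "poly (p 0) z = 0" "z \<notin> \<real>"
  have e: "\<bar>Im z\<bar> > 0" using z(2) by (auto simp: complex_is_Real_iff)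
  have "\<forall>\<^sub>F t in at (0::real). real_rooted (p t) \<and> (\<exists>w. dist w z < \<bar>Im z\<bar> \<and> poly (p t) w = 0)"
    using assms(2) eventually_of_real_nhds[OF poly_family_root_near[OF assms(1,3) z(1) e]]
    by (rule eventually_conj)
  then obtain t :: real where "real_rooted (p t)" "\<exists>w. dist w z < \<bar>Im z\<bar> \<and> poly (p t) w = 0"
    using eventually_happens'[OF at_neq_bot] by blast
  then obtain w where w: "dist w z < \<bar>Im z\<bar>" "w \<in> \<real>" by (auto simp: real_rooted_def)
  have "\<bar>Im (w - z)\<bar> \<le> dist w z" unfolding dist_norm by (rule abs_Im_le_cmod)
  thus False using w by (simp add: complex_is_Real_iff)
qed

text \<open>The bound \<open>M\<close> excludes roots coming in from plus infinity, which a drop of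
  degree at t = 0 would permit. On the compact interval from \<open>c + e\<close> to
  \<open>M\<close> the limit polynomial has positive minimum modulus.\<close>

lemma real_roots_upper_limit:
  fixes c M :: real
  assumes p: "poly_family p" and "\<forall>\<^sub>F t in at_right (0::real). \<forall>x::real. poly (p t) (complex_of_real x) = 0 \<longrightarrow> x \<le> M"
    and max: "\<forall>x::real. poly (p 0) (complex_of_real x) = 0 \<longrightarrow> x \<le> c" and "e > 0"
  shows "\<forall>\<^sub>F t in at_right (0::real). \<forall>x::real. poly (p t) (complex_of_real x) = 0 \<longrightarrow> x < c + e"
proof (cases "c + e \<le> M")
  case False
  thus ?thesis using assms(2) by (auto elim!: eventually_mono)
next
  case True
  have "continuous_on {c + e..M} (\<lambda>x. norm (poly (p 0) (complex_of_real x)))"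
    by (intro continuous_intros)
  then obtain x0 where x0: "x0 \<in> {c + e..M}" "\<And>x. x \<in> {c + e..M} \<Longrightarrow> norm (poly (p 0) (of_real x0)) \<le> norm (poly (p 0) (of_real x))"
    using continuous_attains_inf[of "{c + e..M}"] True by (metis (no_types, lifting) atLeastAtMost_iff compact_Icc empty_iff order_refl)
  define \<eta> where "\<eta> = norm (poly (p 0) (of_real x0))"
  have \<eta>: "\<eta> > 0" unfolding \<eta>_def using max x0(1) \<open>e > 0\<close> by (force simp: not_le)
  show ?thesis
    using assms(2) eventually_of_real_nhds[OF poly_family_uniform[OF p \<eta>, of "\<bar>c + e\<bar> + \<bar>M\<bar>"]]
  proof eventually_elim
    case (elim t)
    show ?case
    proof (intro allI impI, rule ccontr)
      fix x :: real assume x: "poly (p t) x = 0" "\<not> x < c + e"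
      hence xM: "x \<in> {c + e..M}" using elim(1) by auto
      hence "norm (complex_of_real x) \<le> \<bar>c + e\<bar> + \<bar>M\<bar>" by auto
      hence "norm (poly (p t) x - poly (p 0) x) < \<eta>" using elim(2) by blast
      thus False using x0(2)[OF xM] x(1) by (simp add: \<eta>_def)
    qed
  qed
qed


section \<open>The branch of the largest root\<close>

text \<open>Translation by \<gamma> preserves real-rootedness because \<gamma> is real for real t:
  its value is a root of a derivative of a real-rooted polynomial.\<close>

lemma poly_family_recentre:
  assumes p: "poly_family p" and rr: "\<forall>\<^sub>F t in at (0::real). real_rooted (p t)"
    and p0: "p 0 \<noteq> 0" and root: "poly (p 0) c = 0"
  defines "m \<equiv> order c (p 0)"
  obtains \<gamma> where "\<gamma> analytic_on {0}" "\<gamma> 0 = c"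
    "poly_family (\<lambda>t. pcompose (p t) [:\<gamma> t, 1:])"
    "\<forall>\<^sub>F t in at (0::real). \<gamma> t \<in> \<real> \<and> real_rooted (pcompose (p t) [:\<gamma> t, 1:]) \<and>
       coeff (pcompose (p t) [:\<gamma> t, 1:]) m \<noteq> 0 \<and> coeff (pcompose (p t) [:\<gamma> t, 1:]) (m - 1) = 0"
proof -
  have m: "m > 0" using root p0 by (simp add: m_def order_gt_0_iff)
  define r where "r = (\<lambda>t. (pderiv ^^ (m - 1)) (p t))"
  have r: "poly_family r" unfolding r_def by (intro poly_family_higher_pderiv p)
  have "coeff (pcompose (p 0) [:c, 1:]) (m - 1) = 0" "coeff (pcompose (p 0) [:c, 1:]) m \<noteq> 0"
    using coeff_offset_order(1)[OF p0, of "m - 1" c] coeff_offset_order(2)[OF p0, of c] m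
    by (simp_all add: m_def)
  hence "poly (r 0) c = 0" "poly ((pderiv ^^ Suc (m - 1)) (p 0)) c \<noteq> 0"
    unfolding coeff_offset r_def using m by auto
  hence "poly (r 0) c = 0" "poly (pderiv (r 0)) c \<noteq> 0" by (simp_all add: r_def)
  then obtain \<gamma> where \<gamma>: "\<gamma> analytic_on {0}" "\<gamma> 0 = c" "\<forall>\<^sub>F t in nhds 0. poly (r t) (\<gamma> t) = 0"
    using poly_family_simple_root[OF r] by blast
  define q where "q = (\<lambda>t. pcompose (p t) [:\<gamma> t, 1:])"
  have q: "poly_family q" unfolding q_def
    by (intro poly_family_pcompose p poly_family_linear \<gamma> analytic_on_const)
  have "coeff (q 0) m \<noteq> 0" unfolding q_def \<gamma>(2) m_def by (rule coeff_offset_order(2)[OF p0])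
  moreover have "((\<lambda>t. coeff (q t) m) \<longlongrightarrow> coeff (q 0) m) (nhds 0)"
    by (rule isCont_tendsto_compose[OF analytic_at_imp_isCont[OF poly_family_coeff[OF q]] filterlim_ident])
  ultimately have qm: "\<forall>\<^sub>F t in nhds 0. coeff (q t) m \<noteq> 0"
    by (rule tendsto_imp_eventually_ne[rotated])
  have "\<forall>\<^sub>F t in at (0::real). \<gamma> t \<in> \<real> \<and> real_rooted (q t) \<and> coeff (q t) m \<noteq> 0 \<and> coeff (q t) (m - 1) = 0"
    using rr eventually_of_real_nhds[OF qm] eventually_of_real_nhds[OF \<gamma>(3)]
  proof eventually_elim
    case (elim t)
    have "m \<le> degree (p t)"
      using le_degree[OF elim(2)] by (simp add: q_def degree_pcompose)
    hence "real_rooted (r t)" unfolding r_def by (intro real_rooted_higher_pderiv elim(1)) simp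
    hence \<gamma>r: "\<gamma> t \<in> \<real>" using elim(3) by (simp add: real_rooted_def)
    moreover have "real_rooted (q t)"
      unfolding real_rooted_def
    proof (intro allI impI)
      fix z assume "poly (q t) z = 0"
      hence "poly (p t) (\<gamma> t + z) = 0" by (simp add: q_def poly_pcompose)
      hence "\<gamma> t + z \<in> \<real>" using elim(1) by (simp add: real_rooted_def)
      from Reals_diff[OF this \<gamma>r] show "z \<in> \<real>" by simp
    qed
    moreover have "coeff (q t) (m - 1) = 0"
      using elim(3) by (simp add: q_def coeff_offset r_def)
    ultimately show ?case using elim(2) by blast
  qed
  thus ?thesis using that \<gamma>(1,2) q unfolding q_def by blast
qed

text \<open>The cluster does not split: \<gamma> remains a root of multiplicity at least m, and the
  cofactor has no zero near c. A larger root would therefore be far above c, where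
  \<open>real_roots_upper_limit\<close> leaves none.\<close>

lemma branch_if_cluster_stays:
  fixes c M :: real
  assumes p: "poly_family p"
    and bdd: "\<forall>\<^sub>F t in at_right (0::real). \<forall>x::real. poly (p t) (complex_of_real x) = 0 \<longrightarrow> x \<le> M"
    and max: "\<forall>x::real. poly (p 0) (complex_of_real x) = 0 \<longrightarrow> x \<le> c"
    and \<gamma>: "\<gamma> analytic_on {0}" "\<gamma> 0 = of_real c" "\<forall>\<^sub>F t in at (0::real). \<gamma> t \<in> \<real>"
    and m: "coeff (pcompose (p 0) [:\<gamma> 0, 1:]) m \<noteq> 0" "m > 0"
    and zero: "\<forall>\<^sub>F t in at (0::real). \<forall>j<m. coeff (pcompose (p t) [:\<gamma> t, 1:]) j = 0"
  shows "\<forall>\<^sub>F t in at (0::real). poly (p t) (\<gamma> t) = 0"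
    "\<forall>\<^sub>F t in at_right (0::real). \<forall>x::real. poly (p t) (complex_of_real x) = 0 \<longrightarrow> x \<le> Re (\<gamma> t)"
proof -
  define q where "q = (\<lambda>t. pcompose (p t) [:\<gamma> t, 1:])"
  have q: "poly_family q" unfolding q_def
    by (intro poly_family_pcompose p poly_family_linear \<gamma> analytic_on_const)
  have "poly (poly_shift m (q 0)) 0 \<noteq> 0" using m(1) by (simp add: q_def poly_0_coeff_0 coeff_poly_shift)
  then obtain e \<alpha> where e: "e > 0" "\<alpha> > 0"
    "\<forall>\<^sub>F t in nhds 0. \<forall>z. dist z 0 < e \<longrightarrow> \<alpha> \<le> norm (poly (poly_shift m (q t)) z)"
    using poly_family_nonzero_near[OF poly_family_shift[OF q]] by blast
  have "((\<lambda>t. Re (\<gamma> (complex_of_real t))) \<longlongrightarrow> Re (\<gamma> 0)) (at_right 0)"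
    by (intro tendsto_Re analytic_at_0_tendsto \<gamma>)
  hence \<gamma>c: "\<forall>\<^sub>F t in at_right (0::real). Re (\<gamma> t) > c - e / 2"
    by (rule order_tendstoD) (use \<gamma>(2) e(1) in simp)
  have e2: "e / 2 > 0" using e(1) by simp
  have "\<forall>\<^sub>F t in at (0::real). poly (q t) 0 = 0" using zero
    by (rule eventually_mono) (use m(2) in \<open>simp add: poly_0_coeff_0 q_def del: coeff_pcompose_0\<close>)
  thus "\<forall>\<^sub>F t in at (0::real). poly (p t) (\<gamma> t) = 0" by (simp add: q_def poly_pcompose)
  show "\<forall>\<^sub>F t in at_right (0::real). \<forall>x::real. poly (p t) (complex_of_real x) = 0 \<longrightarrow> x \<le> Re (\<gamma> t)"
    using eventually_at_imp_at_within[OF zero] eventually_at_imp_at_within[OF \<gamma>(3)] \<gamma>c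
      eventually_of_real_nhds[OF e(3)] real_roots_upper_limit[OF p bdd max e2]
  proof eventually_elim
    case (elim t)
    show ?case
    proof (intro allI impI, rule ccontr)
      fix x :: real assume x: "poly (p t) x = 0" "\<not> x \<le> Re (\<gamma> t)"
      define y where "y = x - Re (\<gamma> t)"
      \<comment> \<open>The root x is below c + e/2 and \<gamma> is above c - e/2.\<close>
      have y: "y > 0" "y < e" using x elim(3,5) by (auto simp: y_def)
      have "complex_of_real x = \<gamma> t + of_real y" using elim(2) by (simp add: y_def of_real_Re)
      hence "poly (q t) (of_real y) = 0" using x(1) by (simp add: q_def poly_pcompose)
      moreover have "(\<Sum>j<m. coeff (q t) j * of_real y ^ j) = 0"
        using elim(1) by (intro sum.neutral) (simp add: q_def)
      ultimately have "of_real y ^ m * poly (poly_shift m (q t)) (of_real y) = 0"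
        by (simp add: poly_eq_shift[of "q t" _ m])
      hence "poly (poly_shift m (q t)) (of_real y) = 0" using y(1) by simp
      moreover have "\<alpha> \<le> norm (poly (poly_shift m (q t)) (of_real y))"
        using elim(4) y by (simp add: dist_norm)
      ultimately show False using e(2) by simp
    qed
  qed
qed

section \<open>Rescaling a cluster that splits\<close>

text \<open>Otherwise \<open>Q\<close> would be a multiple of (X - c)^m; the missing coefficient of
  degree m - 1 forces c = 0, and then that of degree m - 2 is 0 as well.\<close>

lemma order_less_of_depressed:
  fixes Q :: "complex poly"
  assumes "degree Q = m" "m \<ge> 2" "coeff Q (m - 1) = 0" "coeff Q (m - 2) \<noteq> 0"
  shows "order c Q < m"
proof (rule ccontr)
  have Q0: "Q \<noteq> 0" using assms by auto
  assume "\<not> order c Q < m"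
  hence "order c Q = m" using order_degree[OF Q0, of c] assms(1) by simp
  hence z: "coeff (pcompose Q [:c, 1:]) j = 0" if "j < m" for j
    using coeff_offset_order(1)[OF Q0, of j c] that by simp
  have lc: "coeff Q m \<noteq> 0" using Q0 assms(1) by auto
  have "poly ((pderiv ^^ (m - 1)) Q) c = 0" using z[of "m - 1"] assms(2) by (simp add: coeff_offset)
  moreover have "poly ((pderiv ^^ (m - 1)) Q) c = fact m * coeff Q m * c"
  proof -
    have "degree ((pderiv ^^ (m - 1)) Q) \<le> 1" using assms by (simp add: degree_higher_pderiv)
    moreover have "coeff ((pderiv ^^ (m - 1)) Q) 0 = 0" using assms(3) by (simp add: coeff_higher_pderiv)
    moreover have "coeff ((pderiv ^^ (m - 1)) Q) 1 = fact m * coeff Q m"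
    proof -
      have "pochhammer (of_nat (Suc 1)) (m - 1) = (fact m :: complex)"
        using pochhammer_rec[of "1 :: complex" "m - 1"] assms(2) by (simp add: pochhammer_fact)
      thus ?thesis unfolding coeff_higher_pderiv using assms(2) by simp
    qed
    ultimately show ?thesis by (subst poly_eq_sum_le[of _ 1]) auto
  qed
  ultimately have "c = 0" using lc by simp
  hence "coeff Q (m - 2) = 0" using z[of "m - 2"] assms(2) by simp
  thus False using assms(4) by simp
qed

text \<open>With the mean of the cluster moved to 0, the quotient of the coefficients m - 2 and m is minus a
  positive multiple of a sum of squares of real numbers. So its order at t = 0 is even, say 2k, and
  it dominates the other low coefficients; this is what makes the rescaling by t^k analytic.\<close>

lemma blow_up:
  fixes q :: "complex \<Rightarrow> complex poly"
  assumes q: "poly_family q"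
    and ev: "\<forall>\<^sub>F t in at (0::real). real_rooted (q t) \<and> coeff (q t) m \<noteq> 0 \<and> coeff (q t) (m - 1) = 0"
    and q0: "\<And>j. j < m \<Longrightarrow> coeff (q 0) j = 0" "coeff (q 0) m \<noteq> 0" and m: "m \<ge> 2"
    and moves: "\<not> (\<forall>\<^sub>F t in at (0::real). \<forall>j<m. coeff (q t) j = 0)"
  obtains k Q where "k > 0" "poly_family Q"
    "degree (Q 0) = m" "coeff (Q 0) (m - 1) = 0" "coeff (Q 0) (m - 2) \<noteq> 0"
    "\<forall>\<^sub>F t in at (0::real). \<forall>z. of_real t ^ (k * m) * poly (Q t) z = poly (q t) (of_real t ^ k * z)"
    "\<exists>e>0. \<exists>M. \<forall>\<^sub>F t in at (0::real). \<forall>z. poly (Q t) z = 0 \<longrightarrow> norm (of_real t ^ k * z) < e \<longrightarrow> norm z \<le> M"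
proof -
  obtain n where n: "\<And>t. degree (q t) \<le> n" using poly_family_degree q by blast
  define b where "b = (\<lambda>t. coeff (q t) (m - 2) / coeff (q t) m)"
  have b: "b analytic_on {0}" unfolding b_def
    by (intro analytic_intros poly_family_coeff q) (use q0 in auto)
  have bounds: "\<forall>\<^sub>F t in at (0::real). b t \<in> \<real> \<and> Re (b t) \<le> 0 \<and>
      (\<forall>s\<ge>0. norm (b t) \<le> s\<^sup>2 \<longrightarrow> (\<forall>i\<le>m. norm (coeff (q t) (m - i) / coeff (q t) m) \<le> 2 ^ n * (real n * s) ^ i))"
    using ev
  proof eventually_elim
    case (elim t)
    thus ?case using real_rooted_coeff_bounds[OF _ _ _ m n, of t] unfolding b_def by blast
  qed
  \<comment> \<open>If b vanished, the coefficient bounds with s = 0 would annihilate every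
    coefficient below m, against \<open>moves\<close>.\<close>
  have "\<not> (\<forall>\<^sub>F t in nhds 0. b t = 0)"
  proof
    assume "\<forall>\<^sub>F t in nhds 0. b t = 0"
    from bounds eventually_of_real_nhds[OF this] ev
    have "\<forall>\<^sub>F t in at (0::real). \<forall>j<m. coeff (q t) j = 0"
    proof eventually_elim
      case (elim t)
      show ?case
      proof (intro allI impI)
        fix j assume j: "j < m"
        have "norm (coeff (q t) (m - (m - j)) / coeff (q t) m) \<le> 2 ^ n * (real n * 0) ^ (m - j)"
          using elim(1,2) by (metis diff_le_self norm_zero order_refl zero_power2)
        thus "coeff (q t) j = 0" using elim(3) j by (simp add: power_0_left)
      qed
    qed
    with moves show False by contradiction
  qed
  then obtain N u where u: "u analytic_on {0}" "u 0 \<noteq> 0" "\<forall>\<^sub>F t in nhds 0. b t = t ^ N * u t"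
    using analytic_at_0_factor[OF b] by blast
  have "even N"
  proof (rule even_order_of_nonpos[OF u(1,2)])
    show "\<forall>\<^sub>F t in at (0::real). complex_of_real t ^ N * u t \<in> \<real> \<and> Re (complex_of_real t ^ N * u t) \<le> 0"
      using bounds eventually_of_real_nhds[OF u(3)] by eventually_elim simp
  qed
  then obtain k where N: "N = 2 * k" by (rule evenE)
  have k: "k > 0"
  proof (rule ccontr)
    assume "\<not> k > 0"
    hence "b 0 = u 0" using eventually_nhds_x_imp_x[OF u(3)] N by simp
    thus False using u(2) q0(1)[of "m - 2"] m by (simp add: b_def)
  qed
  obtain B1 where B1: "B1 > 0" "\<forall>\<^sub>F t in nhds 0. norm (u t) \<le> B1"
    using analytic_at_0_bounded[OF u(1)] by blast
  obtain B2 where B2: "B2 > 0" "\<forall>\<^sub>F t in nhds 0. norm (coeff (q t) m) \<le> B2"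
    using analytic_at_0_bounded[OF poly_family_coeff[OF q]] by blast
  define C where "C = (\<lambda>j. B2 * (2 ^ n * (real n * sqrt B1) ^ (m - j)))"
  have "\<exists>d. d analytic_on {0} \<and> (\<forall>\<^sub>F t in nhds 0. coeff (q t) j = t ^ (k * (m - j)) * d t)" if j: "j < m" for j
  proof (rule analytic_at_0_divide_power[OF poly_family_coeff[OF q]])
    show "\<forall>\<^sub>F t in at (0::real). norm (coeff (q t) j) \<le> C j * \<bar>t\<bar> ^ (k * (m - j))"
      using bounds eventually_of_real_nhds[OF u(3)] eventually_of_real_nhds[OF B1(2)]
        eventually_of_real_nhds[OF B2(2)] ev
    proof eventually_elim
      case (elim t)
      \<comment> \<open>The size of the cluster: the square of s is B1 |t|^N and dominates |b t|,
        while its i-th power carries the factor |t|^(k i).\<close>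
      define s where "s = sqrt B1 * \<bar>t\<bar> ^ k"
      have s: "s \<ge> 0" using B1(1) by (simp add: s_def)
      have "norm (b t) = \<bar>t\<bar> ^ N * norm (u t)" using elim(2) by (simp add: norm_mult norm_power)
      also have "\<dots> \<le> \<bar>t\<bar> ^ N * B1" using elim(3) by (intro mult_left_mono) auto
      also have "\<dots> = s\<^sup>2" using B1(1) by (simp add: s_def N power_mult_distrib power_mult[symmetric] mult.commute)
      finally have "norm (coeff (q t) (m - (m - j)) / coeff (q t) m) \<le> 2 ^ n * (real n * s) ^ (m - j)"
        using elim(1) s diff_le_self by blast
      hence "norm (coeff (q t) j) \<le> norm (coeff (q t) m) * (2 ^ n * (real n * s) ^ (m - j))"
        using j elim(5) by (simp add: norm_divide divide_le_eq mult.commute)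
      also have "\<dots> \<le> B2 * (2 ^ n * (real n * s) ^ (m - j))"
        using elim(4) s by (intro mult_right_mono) auto
      also have "\<dots> = C j * \<bar>t\<bar> ^ (k * (m - j))"
        by (simp add: C_def s_def power_mult_distrib power_mult[symmetric] mult_ac)
      finally show ?case .
    qed
  qed
  then obtain d' where d': "\<And>j. j < m \<Longrightarrow> d' j analytic_on {0}"
    "\<And>j. j < m \<Longrightarrow> \<forall>\<^sub>F t in nhds 0. coeff (q t) j = t ^ (k * (m - j)) * d' j t"
    by metis
  \<comment> \<open>The top two indices are set explicitly so that their values at t = 0 can be read
    off: 0 in degree m - 1 and, as N = 2k, a nonzero multiple of \<open>u 0\<close> in degree m -
    2.\<close>
  define d where "d = (\<lambda>j t. if j = m - 1 then 0 else if j = m - 2 then coeff (q t) m * u t else d' j t)"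
  have d: "d j analytic_on {0}" if "j < m" for j
  proof -
    have "(\<lambda>t. coeff (q t) m * u t) analytic_on {0}" by (intro analytic_intros poly_family_coeff q u)
    thus ?thesis using d'(1)[OF that] unfolding d_def
      by (cases "j = m - 1"; cases "j = m - 2") simp_all
  qed
  have deq: "\<forall>\<^sub>F t in at (0::real). coeff (q t) j = of_real t ^ (k * (m - j)) * d j t" if j: "j < m" for j
    using ev eventually_of_real_nhds[OF u(3)] eventually_of_real_nhds[OF d'(2)[OF j]]
  proof eventually_elim
    case (elim t)
    have "coeff (q t) (m - 2) = of_real t ^ (k * 2) * (coeff (q t) m * u t)"
      using elim(1,2) by (simp add: b_def N divide_eq_eq mult_ac)
    moreover have "m - (m - 2) = 2" using m by simp
    ultimately show ?case using elim by (auto simp: d_def)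
  qed
  define g where "g = (\<lambda>t. poly_shift m (q t))"
  have g: "poly_family g" unfolding g_def by (intro poly_family_shift q)
  \<comment> \<open>This is q_t(t^k z) / t^(k m) with the division carried out. Below degree m it
    leaves the \<open>d j\<close>; in the rest the power of t cancels against that of (t^k z)^m. At
    t = 0 only the constant term of \<open>g 0\<close> survives, since k > 0, and the degree is
    m.\<close>
  define Q where "Q = (\<lambda>t. (\<Sum>j<m. monom (d j t) j) + monom 1 m * pcompose (g t) [:0, t ^ k:])"
  have Qp: "poly (Q t) z = (\<Sum>j<m. d j t * z ^ j) + z ^ m * poly (g t) (t ^ k * z)" for t z
    by (simp add: Q_def poly_sum poly_monom poly_pcompose mult.commute)
  have Q: "poly_family Q" unfolding Q_def
    by (intro poly_family_add poly_family_sum poly_family_mult poly_family_pcompose g poly_family_const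
      poly_family_linear analytic_intros poly_family_monom d) auto
  have Q0: "Q 0 = (\<Sum>j<m. monom (d j 0) j) + monom (coeff (q 0) m) m"
    using k by (simp add: Q_def g_def power_0_left pcompose_const mult_monom smult_monom flip: monom_0)
      (simp add: pcompose_0' poly_0_coeff_0 coeff_poly_shift mult_monom flip: monom_0)
  have cQ0: "coeff (Q 0) i = (if i < m then d i 0 else if i = m then coeff (q 0) m else 0)" for i
    unfolding Q0 by (auto simp: coeff_sum)
  have "degree (Q 0) = m" using q0(2) by (intro antisym degree_le le_degree) (auto simp: cQ0)
  moreover have "coeff (Q 0) (m - 1) = 0" using m by (simp add: cQ0 d_def)
  moreover have "coeff (Q 0) (m - 2) \<noteq> 0" using m q0(2) u(2) by (auto simp: cQ0 d_def)
  moreover have "\<forall>\<^sub>F t in at (0::real). \<forall>z. of_real t ^ (k * m) * poly (Q t) z = poly (q t) (of_real t ^ k * z)"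
  proof -
    have "\<forall>\<^sub>F t in at (0::real). \<forall>j\<in>{..<m}. coeff (q t) j = of_real t ^ (k * (m - j)) * d j t"
      by (subst eventually_ball_finite_distrib) (use deq in auto)
    thus ?thesis
    proof eventually_elim
      case (elim t)
      show ?case
      proof
        fix z
        have "of_real t ^ (k * m) * (d j t * z ^ j) = coeff (q t) j * (of_real t ^ k * z) ^ j" if "j < m" for j
        proof -
          have "k * m = k * (m - j) + k * j" using that by (simp flip: distrib_left)
          thus ?thesis using elim that by (simp add: power_add power_mult_distrib power_mult)
        qed
        hence "(\<Sum>j<m. of_real t ^ (k * m) * (d j t * z ^ j)) = (\<Sum>j<m. coeff (q t) j * (of_real t ^ k * z) ^ j)"
          by (intro sum.cong) auto
        thus "of_real t ^ (k * m) * poly (Q t) z = poly (q t) (of_real t ^ k * z)"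
          unfolding Qp poly_eq_shift[of "q t" _ m] g_def
          by (simp add: distrib_left sum_distrib_left power_mult_distrib power_mult mult_ac)
      qed
    qed
  qed
  \<comment> \<open>Cauchy's root bound for the cluster alone: as long as t^k z stays where g is
    bounded below, the term with z^m dominates. Roots outside that disc escape to infinity.\<close>
  moreover have "\<exists>e>0. \<exists>M. \<forall>\<^sub>F t in at (0::real). \<forall>z. poly (Q t) z = 0 \<longrightarrow> norm (of_real t ^ k * z) < e \<longrightarrow> norm z \<le> M"
  proof -
    have "poly (g 0) 0 \<noteq> 0" using q0(2) by (simp add: g_def poly_0_coeff_0 coeff_poly_shift)
    then obtain e \<alpha> where e: "e > 0" "\<alpha> > 0"
      "\<forall>\<^sub>F t in nhds 0. \<forall>z. dist z 0 < e \<longrightarrow> \<alpha> \<le> norm (poly (g t) z)"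
      using poly_family_nonzero_near[OF g] by blast
    have "\<exists>B. B > 0 \<and> (\<forall>\<^sub>F t in nhds 0. norm (d j t) \<le> B)" if "j < m" for j
      using analytic_at_0_bounded[OF d[OF that]] by blast
    then obtain B where B: "\<And>j. j < m \<Longrightarrow> B j > 0" "\<And>j. j < m \<Longrightarrow> \<forall>\<^sub>F t in nhds 0. norm (d j t) \<le> B j"
      by metis
    have "\<forall>\<^sub>F t in nhds 0. \<forall>j\<in>{..<m}. norm (d j t) \<le> B j"
      by (subst eventually_ball_finite_distrib) (use B in auto)
    from eventually_of_real_nhds[OF this] eventually_of_real_nhds[OF e(3)]
    have "\<forall>\<^sub>F t in at (0::real). \<forall>z. poly (Q t) z = 0 \<longrightarrow> norm (of_real t ^ k * z) < e \<longrightarrow>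
       norm z \<le> max 1 ((\<Sum>j<m. B j) / \<alpha>)"
    proof eventually_elim
      case (elim t)
      show ?case
      proof (intro allI impI)
        fix z assume z: "poly (Q t) z = 0" "norm (of_real t ^ k * z) < e"
        show "norm z \<le> max 1 ((\<Sum>j<m. B j) / \<alpha>)"
        proof (cases "norm z \<le> 1")
          case False
          have "z ^ m * poly (g t) (of_real t ^ k * z) = - (\<Sum>j<m. d j t * z ^ j)"
            using z(1) unfolding Qp by (simp add: eq_neg_iff_add_eq_0 add.commute)
          hence "norm z ^ m * norm (poly (g t) (of_real t ^ k * z)) = norm (\<Sum>j<m. d j t * z ^ j)"
            by (metis norm_minus_cancel norm_mult norm_power)
          also have "\<dots> \<le> (\<Sum>j<m. B j * norm z ^ (m - 1))"
          proof (intro sum_norm_le)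
            fix j assume "j \<in> {..<m}"
            thus "norm (d j t * z ^ j) \<le> B j * norm z ^ (m - 1)"
              using elim(1) False less_imp_le[OF B(1)] unfolding norm_mult norm_power
              by (intro mult_mono power_increasing) auto
          qed
          also have "\<dots> = (\<Sum>j<m. B j) * norm z ^ (m - 1)" by (simp add: sum_distrib_right)
          finally have 1: "norm z ^ m * norm (poly (g t) (of_real t ^ k * z)) \<le> (\<Sum>j<m. B j) * norm z ^ (m - 1)" .
          have "\<alpha> \<le> norm (poly (g t) (of_real t ^ k * z))" using elim(2) z(2) by (simp add: dist_norm)
          hence "norm z ^ m * \<alpha> \<le> norm z ^ m * norm (poly (g t) (of_real t ^ k * z))"
            by (intro mult_left_mono) auto
          also note 1
          finally have "norm z ^ (m - 1) * (norm z * \<alpha>) \<le> norm z ^ (m - 1) * (\<Sum>j<m. B j)"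
            using m by (cases m) (simp_all add: mult_ac)
          moreover have "norm z ^ (m - 1) > 0" using False by (intro zero_less_power) linarith
          ultimately have "norm z * \<alpha> \<le> (\<Sum>j<m. B j)" by (simp only: mult_le_cancel_left_pos)
          hence "norm z \<le> (\<Sum>j<m. B j) / \<alpha>" using e(2) by (simp add: le_divide_eq)
          thus ?thesis by simp
        qed simp
      qed
    qed
    thus ?thesis using e(1) by blast
  qed
  ultimately show ?thesis using that[OF k Q] by blast
qed

text \<open>The induction on the multiplicity needs a statement that is stable under rescaling. This
  explains \<open>M\<close>: a bound from above, for t > 0 only, is what survives when the roots
  outside the cluster are stretched by t^(-k).\<close>

proposition largest_root_branch:
  fixes c M :: real
  assumes "poly_family p" "\<forall>\<^sub>F t in at (0::real). real_rooted (p t)"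
    and "\<forall>\<^sub>F t in at_right (0::real). \<forall>x::real. poly (p t) (complex_of_real x) = 0 \<longrightarrow> x \<le> M"
    and "p 0 \<noteq> 0" "poly (p 0) (of_real c) = 0" "\<forall>x::real. poly (p 0) (complex_of_real x) = 0 \<longrightarrow> x \<le> c"
  shows "\<exists>\<mu>. \<mu> analytic_on {0} \<and> \<mu> 0 = of_real c \<and>
    (\<forall>\<^sub>F t in at (0::real). poly (p t) (\<mu> t) = 0) \<and>
    (\<forall>\<^sub>F t in at_right (0::real). \<forall>x::real. poly (p t) (complex_of_real x) = 0 \<longrightarrow> x \<le> Re (\<mu> t))"
  using assms
proof (induction "order (complex_of_real c) (p 0)" arbitrary: p c M rule: less_induct)
  case (less p c M)
  note p = less.prems(1) and rr = less.prems(2) and bdd = less.prems(3)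
    and p0 = less.prems(4) and root = less.prems(5) and max = less.prems(6)
  define m where "m = order (complex_of_real c) (p 0)"
  have m: "m > 0" using root p0 by (simp add: m_def order_gt_0_iff)
  obtain \<gamma> where \<gamma>: "\<gamma> analytic_on {0}" "\<gamma> 0 = of_real c"
    and q: "poly_family (\<lambda>t. pcompose (p t) [:\<gamma> t, 1:])"
    and ev: "\<forall>\<^sub>F t in at (0::real). \<gamma> t \<in> \<real> \<and> real_rooted (pcompose (p t) [:\<gamma> t, 1:]) \<and>
       coeff (pcompose (p t) [:\<gamma> t, 1:]) m \<noteq> 0 \<and> coeff (pcompose (p t) [:\<gamma> t, 1:]) (m - 1) = 0"
    using poly_family_recentre[OF p rr p0 root] unfolding m_def by blast
  define q where "q = (\<lambda>t. pcompose (p t) [:\<gamma> t, 1:])"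
  have q_eq: "pcompose (p t) [:\<gamma> t, 1:] = q t" for t by (simp add: q_def)
  note q = q[unfolded q_eq] and ev = ev[unfolded q_eq]
  have q0: "coeff (q 0) j = 0" if "j < m" for j
    using coeff_offset_order(1)[OF p0, of j "of_real c"] that by (simp add: m_def q_def \<gamma>(2))
  have qm: "coeff (q 0) m \<noteq> 0"
    using coeff_offset_order(2)[OF p0, of "of_real c"] by (simp add: m_def q_def \<gamma>(2))
  have \<gamma>_real: "\<forall>\<^sub>F t in at (0::real). \<gamma> t \<in> \<real>" using ev by (rule eventually_mono) blast
  show ?case
  proof (cases "\<forall>\<^sub>F t in at (0::real). \<forall>j<m. coeff (q t) j = 0")
    case True
    from branch_if_cluster_stays[OF p bdd max \<gamma> \<gamma>_real qm[unfolded q_def] m True[unfolded q_def]] \<gamma>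
    show ?thesis by blast
  next
    case False
    \<comment> \<open>For a simple root the only coefficient below m is the one that recentring has
      already removed.\<close>
    have "m \<noteq> 1"
    proof
      assume "m = 1"
      have "\<forall>\<^sub>F t in at (0::real). \<forall>j<m. coeff (q t) j = 0"
        using ev by (rule eventually_mono) (simp add: \<open>m = 1\<close>)
      with False show False by contradiction
    qed
    hence m2: "m \<ge> 2" using m by simp
    have "\<forall>\<^sub>F t in at (0::real). real_rooted (q t) \<and> coeff (q t) m \<noteq> 0 \<and> coeff (q t) (m - 1) = 0"
      using ev by (rule eventually_mono) blast
    then obtain k Q where k: "k > 0" and Q: "poly_family Q"
      and Q0: "degree (Q 0) = m" "coeff (Q 0) (m - 1) = 0" "coeff (Q 0) (m - 2) \<noteq> 0"
      and scale: "\<forall>\<^sub>F t in at (0::real). \<forall>z. of_real t ^ (k * m) * poly (Q t) z = poly (q t) (of_real t ^ k * z)"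
      and Qbdd: "\<exists>e>0. \<exists>M. \<forall>\<^sub>F t in at (0::real). \<forall>z. poly (Q t) z = 0 \<longrightarrow> norm (of_real t ^ k * z) < e \<longrightarrow> norm z \<le> M"
      by (rule blow_up[OF q _ q0 qm m2 False])
    have nz: "\<forall>\<^sub>F t in at (0::real). t \<noteq> 0" by (rule eventually_neq_at_within)
    have QR: "\<forall>\<^sub>F t in at (0::real). real_rooted (Q t)"
      using ev scale nz
    proof eventually_elim
      case (elim t)
      show ?case unfolding real_rooted_def
      proof (intro allI impI)
        fix z assume "poly (Q t) z = 0"
        hence "poly (q t) (of_real t ^ k * z) = 0" using elim(2) by (metis mult_zero_right)
        hence "of_real t ^ k * z \<in> \<real>" using elim(1) by (simp add: real_rooted_def)
        hence "of_real t ^ k * z / of_real t ^ k \<in> \<real>" by (intro Reals_divide Reals_power Reals_of_real)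
        thus "z \<in> \<real>" using elim(3) by simp
      qed
    qed
    have Q0nz: "Q 0 \<noteq> 0" using Q0(3) by auto
    define R where "R = {x::real. poly (Q 0) x = 0}"
    have "complex_of_real ` R \<subseteq> {z. poly (Q 0) z = 0}" by (auto simp: R_def)
    hence "finite (complex_of_real ` R)" using poly_roots_finite[OF Q0nz] finite_subset by blast
    hence finR: "finite R" by (rule finite_imageD) (simp add: inj_on_def)
    obtain z where z: "poly (Q 0) z = 0"
      using fundamental_theorem_of_algebra_alt[of "Q 0"] Q0(1) m by force
    moreover have "z \<in> \<real>" using real_rooted_limit[OF Q QR Q0nz] z by (simp add: real_rooted_def)
    ultimately have Rne: "R \<noteq> {}" by (auto simp: R_def elim: Reals_cases)
    \<comment> \<open>The recursion restarts at the largest root of the rescaled limit, which is the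
      coefficient of t^k in the largest root of \<open>p t\<close> relative to \<gamma>.\<close>
    define c' where "c' = Max R"
    have c': "poly (Q 0) (of_real c') = 0" "\<forall>x::real. poly (Q 0) (complex_of_real x) = 0 \<longrightarrow> x \<le> c'"
      using Max_in[OF finR Rne] Max_ge[OF finR] by (auto simp: c'_def R_def)
    have ord: "order (complex_of_real c') (Q 0) < order (complex_of_real c) (p 0)"
      unfolding m_def[symmetric] by (rule order_less_of_depressed[OF Q0(1) m2 Q0(2,3)])
    obtain e M' where e: "e > 0" and
      M': "\<forall>\<^sub>F t in at (0::real). \<forall>z. poly (Q t) z = 0 \<longrightarrow> norm (of_real t ^ k * z) < e \<longrightarrow> norm z \<le> M'"
      using Qbdd by blast
    have "((\<lambda>t. Re (\<gamma> (complex_of_real t))) \<longlongrightarrow> Re (\<gamma> 0)) (at_right 0)"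
      by (intro tendsto_Re analytic_at_0_tendsto \<gamma>)
    hence \<gamma>c: "\<forall>\<^sub>F t in at_right (0::real). Re (\<gamma> t) > c - e / 2"
      by (rule order_tendstoD) (use \<gamma>(2) e in simp)
    have e2: "e / 2 > 0" using e by simp
    have pos: "\<forall>\<^sub>F t in at_right (0::real). t > 0" by (rule eventually_at_right_less)
    have pq: "poly (p t) (\<gamma> t + z) = poly (q t) z" for t z by (simp add: q_def poly_pcompose)
    \<comment> \<open>A positive root x of \<open>Q t\<close> yields the root \<gamma> + t^k x of
      \<open>p t\<close>, which is below c + e/2. So t^k x < e and the cluster bound
      \<open>M'\<close> applies; negative roots need no lower bound.\<close>
    have "\<forall>\<^sub>F t in at_right (0::real). \<forall>x::real. poly (Q t) (complex_of_real x) = 0 \<longrightarrow> x \<le> max 0 M'"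
      using eventually_at_imp_at_within[OF scale] eventually_at_imp_at_within[OF M']
        eventually_at_imp_at_within[OF \<gamma>_real] \<gamma>c real_roots_upper_limit[OF p bdd max e2] pos
    proof eventually_elim
      case (elim t)
      show ?case
      proof (intro allI impI)
        fix x :: real assume x: "poly (Q t) x = 0"
        show "x \<le> max 0 M'"
        proof (cases "x \<le> 0")
          case False
          define y where "y = t ^ k * x"
          have y: "y > 0" using False elim(6) by (simp add: y_def)
          have "poly (q t) (of_real y) = 0" using elim(1) x by (simp add: y_def) (metis mult_zero_right)
          hence "poly (p t) (of_real (Re (\<gamma> t) + y)) = 0"
            using pq[of t "of_real y"] elim(3) by (simp add: of_real_Re)
          hence "Re (\<gamma> t) + y < c + e / 2" using elim(5) by blast
          hence "y < e" using elim(4) by simp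
          hence "norm (of_real t ^ k * complex_of_real x) < e"
            using y unfolding y_def by (simp flip: of_real_power of_real_mult)
          hence "norm (complex_of_real x) \<le> M'" using elim(2) x by blast
          thus ?thesis by simp
        qed simp
      qed
    qed
    from less.hyps[OF ord Q QR this Q0nz c']
    obtain \<nu> where \<nu>: "\<nu> analytic_on {0}"
      "\<forall>\<^sub>F t in at (0::real). poly (Q t) (\<nu> t) = 0"
      "\<forall>\<^sub>F t in at_right (0::real). \<forall>x::real. poly (Q t) (complex_of_real x) = 0 \<longrightarrow> x \<le> Re (\<nu> t)" by blast
    define \<mu> where "\<mu> = (\<lambda>t. \<gamma> t + t ^ k * \<nu> t)"
    have "\<mu> analytic_on {0}" unfolding \<mu>_def by (intro analytic_intros \<gamma> \<nu>)
    moreover have "\<mu> 0 = of_real c" using k \<gamma>(2) by (simp add: \<mu>_def)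
    moreover have "\<forall>\<^sub>F t in at (0::real). poly (p t) (\<mu> t) = 0"
      using scale \<nu>(2)
    proof eventually_elim
      case (elim t)
      show ?case unfolding \<mu>_def pq using elim by (metis mult_zero_right)
    qed
    moreover have "\<forall>\<^sub>F t in at_right (0::real). \<forall>x::real. poly (p t) (complex_of_real x) = 0 \<longrightarrow> x \<le> Re (\<mu> t)"
      using eventually_at_imp_at_within[OF scale] \<nu>(3) eventually_at_imp_at_within[OF \<gamma>_real] pos
    proof eventually_elim
      case (elim t)
      show ?case
      proof (intro allI impI)
        fix x :: real assume x: "poly (p t) x = 0"
        define z where "z = (x - Re (\<gamma> t)) / t ^ k"
        have tz: "t ^ k * z = x - Re (\<gamma> t)" using elim(4) by (simp add: z_def)
        have "poly (q t) (of_real t ^ k * of_real z) = 0"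
        proof -
          have "complex_of_real t ^ k * of_real z = of_real (x - Re (\<gamma> t))" by (simp flip: tz)
          also have "\<gamma> t + \<dots> = of_real x" using elim(3) by (simp add: of_real_Re)
          finally show ?thesis using pq x by metis
        qed
        hence "complex_of_real t ^ (k * m) * poly (Q t) (of_real z) = 0" using elim(1) by simp
        hence "poly (Q t) (of_real z) = 0" using elim(4) by simp
        hence "z \<le> Re (\<nu> t)" using elim(2) by blast
        hence "t ^ k * z \<le> t ^ k * Re (\<nu> t)" using elim(4) by (intro mult_left_mono) auto
        moreover have "Re (\<mu> t) = Re (\<gamma> t) + t ^ k * Re (\<nu> t)"
          unfolding \<mu>_def by (simp flip: of_real_power)
        ultimately show "x \<le> Re (\<mu> t)" using tz by simp
      qed
    qed
    ultimately show ?thesis by blast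
  qed
qed


section \<open>Gluing the two branches at a local maximizer\<close>

text \<open>\<open>W'\<close> is negative just left of x and positive just right of it; the mean
  value theorem turns this into the sign of \<open>W\<close> on both sides.\<close>

lemma pos_near_strict_min:
  fixes W :: "real \<Rightarrow> real"
  assumes "e > 0" "\<And>s. s \<in> ball x e \<Longrightarrow> (W has_real_derivative W' s) (at s)"
    "(W' has_real_derivative w) (at x)" "w > 0" "W x = 0" "W' x = 0"
  shows "\<forall>\<^sub>F s in at x. W s > 0"
proof -
  obtain d1 where d1: "d1 > 0" "\<And>h. h > 0 \<Longrightarrow> h < d1 \<Longrightarrow> W' x < W' (x + h)"
    using DERIV_pos_inc_right[OF assms(3,4)] by blast
  obtain d2 where d2: "d2 > 0" "\<And>h. h > 0 \<Longrightarrow> h < d2 \<Longrightarrow> W' (x - h) < W' x"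
    using DERIV_pos_inc_left[OF assms(3,4)] by blast
  define d where "d = min e (min d1 d2)"
  have "W s > 0" if s: "s \<noteq> x" "dist s x < d" for s
  proof (cases "s > x")
    case True
    have "\<exists>z. x < z \<and> z < s \<and> W s - W x = (s - x) * W' z"
      using True s by (intro MVT2 assms(2)) (auto simp: d_def dist_real_def)
    then obtain z where z: "x < z" "z < s" "W s - W x = (s - x) * W' z" by blast
    hence "W' z > 0" using d1(2)[of "z - x"] s True assms(6) by (simp add: d_def dist_real_def)
    hence "(s - x) * W' z > 0" using True by (intro mult_pos_pos) auto
    thus ?thesis using z(3) assms(5) by simp
  next
    case False
    hence sx: "s < x" using s by simp
    have "\<exists>z. s < z \<and> z < x \<and> W x - W s = (x - s) * W' z"
      using sx s by (intro MVT2 assms(2)) (auto simp: d_def dist_real_def)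
    then obtain z where z: "s < z" "z < x" "W x - W s = (x - s) * W' z" by blast
    hence "W' z < 0" using d2(2)[of "x - z"] s sx assms(6) by (simp add: d_def dist_real_def)
    hence "(x - s) * W' z < 0" using sx by (intro mult_pos_neg) auto
    thus ?thesis using z(3) assms(5) by simp
  qed
  moreover have "d > 0" using assms(1) d1(1) d2(1) by (simp add: d_def)
  ultimately show ?thesis unfolding eventually_at by blast
qed

lemma has_real_derivative_glue:
  fixes g h :: "real \<Rightarrow> real"
  assumes "(g has_real_derivative g' s) (at s)" "(h has_real_derivative h' s) (at s)"
    and "s = x \<Longrightarrow> g x = h x \<and> g' x = h' x"
  shows "((\<lambda>s. if s \<ge> x then g s else h s) has_real_derivative (if s \<ge> x then g' s else h' s)) (at s)"
proof (cases s x rule: linorder_cases)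
  case less
  show ?thesis
    by (rule has_field_derivative_transform_within_open[of h _ _ "{..<x}"]) (use less assms(2) in auto)
next
  case greater
  show ?thesis
    by (rule has_field_derivative_transform_within_open[of g _ _ "{x<..}"]) (use greater assms(1) in auto)
next
  case equal
  define k where "k = (\<lambda>s. if s \<ge> x then g s else h s)"
  have "((\<lambda>y. (k y - k x) / (y - x)) \<longlongrightarrow> g' x) (at x)"
  proof (rule filterlim_split_at)
    have "((\<lambda>y. (h y - h x) / (y - x)) \<longlongrightarrow> h' x) (at_left x)"
      using assms(2) equal unfolding has_field_derivative_iff by (auto intro: tendsto_mono[OF at_le])
    hence "((\<lambda>y. (h y - h x) / (y - x)) \<longlongrightarrow> g' x) (at_left x)" using assms(3)[OF equal] by simp
    moreover have "\<forall>\<^sub>F y in at_left x. (h y - h x) / (y - x) = (k y - k x) / (y - x)"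
      using assms(3)[OF equal] by (auto simp: eventually_at_filter k_def)
    ultimately show "((\<lambda>y. (k y - k x) / (y - x)) \<longlongrightarrow> g' x) (at_left x)"
      by (rule Lim_transform_eventually)
    have "((\<lambda>y. (g y - g x) / (y - x)) \<longlongrightarrow> g' x) (at_right x)"
      using assms(1) equal unfolding has_field_derivative_iff by (auto intro: tendsto_mono[OF at_le])
    moreover have "\<forall>\<^sub>F y in at_right x. (g y - g x) / (y - x) = (k y - k x) / (y - x)"
      by (auto simp: eventually_at_filter k_def)
    ultimately show "((\<lambda>y. (k y - k x) / (y - x)) \<longlongrightarrow> g' x) (at_right x)"
      by (rule Lim_transform_eventually)
  qed
  thus ?thesis using equal by (simp add: has_field_derivative_iff k_def)
qed

text \<open>Here \<open>G i\<close> and \<open>K i\<close> are the i-th derivatives of the two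
  branches. Agreement up to order 2 makes the glued functions of order 0 and 1 differentiable; the
  one of order 2 is merely Lipschitz, as the third derivatives may differ at x.\<close>

lemma C2_glue:
  fixes G K :: "nat \<Rightarrow> real \<Rightarrow> real" and f :: "real \<Rightarrow> real"
  assumes e: "e > 0"
    and G: "\<And>i s. s \<in> ball x e \<Longrightarrow> (G i has_real_derivative G (Suc i) s) (at s)"
    and K: "\<And>i s. s \<in> ball x e \<Longrightarrow> (K i has_real_derivative K (Suc i) s) (at s)"
    and bound: "\<And>s. s \<in> ball x e \<Longrightarrow> \<bar>G 3 s\<bar> \<le> B \<and> \<bar>K 3 s\<bar> \<le> B"
    and eq: "\<And>i. i \<le> 2 \<Longrightarrow> G i x = K i x"
    and f: "\<And>s. s \<in> ball x e \<Longrightarrow> f s = (if s \<ge> x then G 0 s else K 0 s)"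
  shows "C2_on (ball x e) f" "B-lipschitz_on (ball x e) (deriv (deriv f))"
proof -
  define k where "k = (\<lambda>i s. if s \<ge> x then G i s else K i s)"
  have k: "(k i has_real_derivative k (Suc i) s) (at s)" if "i < 2" "s \<in> ball x e" for i s
    unfolding k_def by (intro has_real_derivative_glue G K that) (use eq that in simp)
  have f1: "(f has_real_derivative k 1 s) (at s)" if "s \<in> ball x e" for s
    by (rule has_field_derivative_transform_within_open[of "k 0" _ _ "ball x e"])
      (use k[of 0 s] that f in \<open>auto simp: k_def\<close>)
  have d1: "deriv f s = k 1 s" if "s \<in> ball x e" for s using f1[OF that] by (rule DERIV_imp_deriv)
  have f2: "(deriv f has_real_derivative k 2 s) (at s)" if "s \<in> ball x e" for s
    by (rule has_field_derivative_transform_within_open[of "k 1" _ _ "ball x e"])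
      (use k[of 1 s] that d1 in \<open>simp_all add: numeral_2_eq_2\<close>)
  have d2: "deriv (deriv f) s = k 2 s" if "s \<in> ball x e" for s using f2[OF that] by (rule DERIV_imp_deriv)
  have lipG: "\<bar>G 2 s - G 2 t\<bar> \<le> B * \<bar>s - t\<bar>" if "s \<in> ball x e" "t \<in> ball x e" for s t
    unfolding real_norm_def[symmetric]
    by (rule field_differentiable_bound[of "ball x e" _ "G 3"])
      (use that bound G[of _ 2] in \<open>auto simp: numeral_3_eq_3 numeral_2_eq_2 intro: has_field_derivative_at_within\<close>)
  have lipK: "\<bar>K 2 s - K 2 t\<bar> \<le> B * \<bar>s - t\<bar>" if "s \<in> ball x e" "t \<in> ball x e" for s t
    unfolding real_norm_def[symmetric]
    by (rule field_differentiable_bound[of "ball x e" _ "K 3"])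
      (use that bound K[of _ 2] in \<open>auto simp: numeral_3_eq_3 numeral_2_eq_2 intro: has_field_derivative_at_within\<close>)
  have x: "x \<in> ball x e" using e by simp
  \<comment> \<open>Points on opposite sides are compared through x, where the second derivatives
    agree. The constant stays \<open>B\<close> because the two distances add up to |s - t|.\<close>
  have lip_mixed: "\<bar>k 2 s - k 2 t\<bar> \<le> B * \<bar>s - t\<bar>" if "s \<in> ball x e" "t \<in> ball x e" "s \<le> t" for s t
  proof (cases "s < x \<and> x \<le> t")
    case True
    have "\<bar>k 2 s - k 2 t\<bar> \<le> \<bar>K 2 s - K 2 x\<bar> + \<bar>G 2 x - G 2 t\<bar>"
      using True eq[of 2] by (simp add: k_def)
    also have "\<dots> \<le> B * \<bar>s - x\<bar> + B * \<bar>x - t\<bar>" by (intro add_mono lipG lipK that x)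
    also have "\<dots> = B * \<bar>s - t\<bar>" using True by (simp add: algebra_simps)
    finally show ?thesis .
  next
    case False
    thus ?thesis using lipG[OF that(1,2)] lipK[OF that(1,2)] that(3) by (auto simp: k_def)
  qed
  show lip: "B-lipschitz_on (ball x e) (deriv (deriv f))"
  proof (rule lipschitz_onI)
    show "0 \<le> B" using bound[OF x] by linarith
    fix s t assume st: "s \<in> ball x e" "t \<in> ball x e"
    show "dist (deriv (deriv f) s) (deriv (deriv f) t) \<le> B * dist s t"
      unfolding d2[OF st(1)] d2[OF st(2)] dist_real_def
      using lip_mixed[OF st] lip_mixed[OF st(2,1)] by (cases "s \<le> t") (auto simp: abs_minus_commute)
  qed
  show "C2_on (ball x e) f"
    unfolding C2_on_def real_differentiable_def
    using f1 f2 lipschitz_on_continuous_on[OF lip] by blast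
qed

lemma Re_has_real_derivative:
  assumes "(\<phi> has_field_derivative D) (at (complex_of_real (s - x)))"
  shows "((\<lambda>s. Re (\<phi> (complex_of_real (s - x)))) has_real_derivative Re D) (at s)"
proof -
  have "((\<lambda>s. complex_of_real (s - x)) has_derivative (\<lambda>h. complex_of_real h)) (at s)"
    by (auto intro!: derivative_eq_intros)
  from has_derivative_compose[OF this assms[unfolded has_field_derivative_def]]
  have "((\<lambda>s. \<phi> (complex_of_real (s - x))) has_derivative (\<lambda>h. D * complex_of_real h)) (at s)" .
  from bounded_linear.has_derivative[OF bounded_linear_Re this]
  show ?thesis by (simp add: has_field_derivative_def mult_commute_abs)
qed

text \<open>The conclusion covers every radius up to e0, so that the ball can later be shrunk into
  the domain.\<close>

lemma C2_at_max_of_two_branches: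
  fixes f :: "real \<Rightarrow> real"
  assumes \<mu>: "\<mu> analytic_on {0}" and \<nu>: "\<nu> analytic_on {0}"
    and at0: "Re (\<mu> 0) = f x" "Re (\<nu> 0) = f x"
    and right: "\<forall>\<^sub>F s in at_right x. f s = Re (\<mu> (of_real (s - x)))"
    and left: "\<forall>\<^sub>F s in at_left x. f s = Re (\<nu> (of_real (s - x)))"
    and below: "\<forall>\<^sub>F s in at x. Re (\<mu> (of_real (s - x))) \<le> f s"
      "\<forall>\<^sub>F s in at x. Re (\<nu> (of_real (s - x))) \<le> f s"
    and max: "\<forall>\<^sub>F s in at x. f s \<le> f x"
  shows "\<exists>e0>0. \<forall>e. 0 < e \<longrightarrow> e \<le> e0 \<longrightarrow> C2_on (ball x e) f \<and> (\<exists>L. L-lipschitz_on (ball x e) (deriv (deriv f)))"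
proof -
  define G where "G = (\<lambda>i s. Re ((deriv ^^ i) \<mu> (complex_of_real (s - x))))"
  define K where "K = (\<lambda>i s. Re ((deriv ^^ i) \<nu> (complex_of_real (s - x))))"
  obtain d1 where d1: "d1 > 0" "\<mu> holomorphic_on ball 0 d1" using \<mu> by (auto simp: analytic_at_ball)
  obtain d2 where d2: "d2 > 0" "\<nu> holomorphic_on ball 0 d2" using \<nu> by (auto simp: analytic_at_ball)
  define d where "d = min d1 d2"
  have d: "d > 0" using d1 d2 by (simp add: d_def)
  have hol: "(deriv ^^ i) \<mu> holomorphic_on ball 0 d" "(deriv ^^ i) \<nu> holomorphic_on ball 0 d" for i
    by (rule holomorphic_on_subset[OF holomorphic_higher_deriv[OF d1(2) open_ball]], simp add: d_def subset_ball)
       (rule holomorphic_on_subset[OF holomorphic_higher_deriv[OF d2(2) open_ball]], simp add: d_def subset_ball)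
  have in_ball: "complex_of_real (s - x) \<in> ball 0 d" if "s \<in> ball x d" for s
    using that by (simp add: dist_real_def abs_minus_commute del: of_real_diff)
  have GD: "(G i has_real_derivative G (Suc i) s) (at s)" if "s \<in> ball x d" for i s
    unfolding G_def by (intro Re_has_real_derivative)
      (simp add: holomorphic_derivI[OF hol(1) open_ball in_ball[OF that]] del: of_real_diff)
  have KD: "(K i has_real_derivative K (Suc i) s) (at s)" if "s \<in> ball x d" for i s
    unfolding K_def by (intro Re_has_real_derivative)
      (simp add: holomorphic_derivI[OF hol(2) open_ball in_ball[OF that]] del: of_real_diff)
  have Gx: "G 0 x = f x" "K 0 x = f x" using at0 by (simp_all add: G_def K_def)
  have xd: "x \<in> ball x d" using d by simp
  \<comment> \<open>Near x one has g <= f <= f x = g x: a function touching f from below inherits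
    its local maximum.\<close>
  have crit: "g' = 0" if "(g has_real_derivative g') (at x)" "g x = f x" "\<forall>\<^sub>F s in at x. g s \<le> f s" for g g'
  proof -
    have "\<forall>\<^sub>F s in at x. g s \<le> g x"
      using that(3) max by eventually_elim (use that(2) in simp)
    then obtain r where "r > 0" "\<And>s. s \<noteq> x \<Longrightarrow> dist s x < r \<Longrightarrow> g s \<le> g x"
      unfolding eventually_at by blast
    hence "\<forall>y. \<bar>x - y\<bar> < r \<longrightarrow> g y \<le> g x" by (metis abs_minus_commute dist_real_def order_refl)
    with that(1) \<open>r > 0\<close> show ?thesis by (rule DERIV_local_max)
  qed
  have G1: "G 1 x = 0" using crit[OF GD[OF xd, of 0]] Gx below(1) by (simp add: G_def)
  have K1: "K 1 x = 0" using crit[OF KD[OF xd, of 0]] Gx below(2) by (simp add: K_def)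
  \<comment> \<open>Otherwise G would exceed K to the left of x too, where f equals K and is at
    least G. The opposite inequality is refuted on the right.\<close>
  have "\<not> G 2 x > K 2 x"
  proof
    assume *: "G 2 x > K 2 x"
    have "\<forall>\<^sub>F s in at x. G 0 s - K 0 s > 0"
    proof (rule pos_near_strict_min[OF d])
      show "((\<lambda>s. G 0 s - K 0 s) has_real_derivative G 1 s - K 1 s) (at s)" if "s \<in> ball x d" for s
        using DERIV_diff[OF GD[OF that] KD[OF that], of 0 0] by simp
      show "((\<lambda>s. G 1 s - K 1 s) has_real_derivative G 2 x - K 2 x) (at x)"
        using DERIV_diff[OF GD[OF xd] KD[OF xd], of 1 1] by (simp add: numeral_2_eq_2)
    qed (use * Gx G1 K1 in auto)
    from eventually_at_imp_at_within[OF this] eventually_at_imp_at_within[OF below(1)] left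
    have "\<forall>\<^sub>F s in at_left x. False" by eventually_elim (simp add: G_def K_def)
    thus False by simp
  qed
  moreover have "\<not> K 2 x > G 2 x"
  proof
    assume *: "K 2 x > G 2 x"
    have "\<forall>\<^sub>F s in at x. K 0 s - G 0 s > 0"
    proof (rule pos_near_strict_min[OF d])
      show "((\<lambda>s. K 0 s - G 0 s) has_real_derivative K 1 s - G 1 s) (at s)" if "s \<in> ball x d" for s
        using DERIV_diff[OF KD[OF that] GD[OF that], of 0 0] by simp
      show "((\<lambda>s. K 1 s - G 1 s) has_real_derivative K 2 x - G 2 x) (at x)"
        using DERIV_diff[OF KD[OF xd] GD[OF xd], of 1 1] by (simp add: numeral_2_eq_2)
    qed (use * Gx G1 K1 in auto)
    from eventually_at_imp_at_within[OF this] eventually_at_imp_at_within[OF below(2)] right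
    have "\<forall>\<^sub>F s in at_right x. False" by eventually_elim (simp add: G_def K_def)
    thus False by simp
  qed
  ultimately have G2: "G 2 x = K 2 x" by simp
  have eq: "G i x = K i x" if "i \<le> 2" for i
  proof -
    have "i = 0 \<or> i = 1 \<or> i = 2" using that by auto
    thus ?thesis using Gx G1 K1 G2 by auto
  qed
  \<comment> \<open>Halving the radius gives a compact disc, on which the third derivatives are
    bounded.\<close>
  have cpt: "compact ((deriv ^^ 3) \<phi> ` cball 0 (d / 2))" if "(deriv ^^ 3) \<phi> holomorphic_on ball 0 d" for \<phi> :: "complex \<Rightarrow> complex"
    by (intro compact_continuous_image holomorphic_on_imp_continuous_on holomorphic_on_subset[OF that]) (use d in auto)
  obtain B1 where B1: "\<And>z. z \<in> cball 0 (d / 2) \<Longrightarrow> norm ((deriv ^^ 3) \<mu> z) \<le> B1"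
    using compact_imp_bounded[OF cpt[OF hol(1)]] unfolding bounded_iff by blast
  obtain B2 where B2: "\<And>z. z \<in> cball 0 (d / 2) \<Longrightarrow> norm ((deriv ^^ 3) \<nu> z) \<le> B2"
    using compact_imp_bounded[OF cpt[OF hol(2)]] unfolding bounded_iff by blast
  obtain r1 where r1: "r1 > 0" "\<And>s. x < s \<Longrightarrow> s < x + r1 \<Longrightarrow> f s = G 0 s"
    using right unfolding eventually_at by (auto simp: dist_real_def G_def)
  obtain r2 where r2: "r2 > 0" "\<And>s. s < x \<Longrightarrow> x - r2 < s \<Longrightarrow> f s = K 0 s"
    using left unfolding eventually_at by (auto simp: dist_real_def K_def)
  define e0 where "e0 = min (d / 2) (min r1 r2)"
  have e0: "e0 > 0" using d r1 r2 by (simp add: e0_def)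
  show ?thesis
  proof (rule exI[of _ e0], intro conjI e0 allI impI)
    fix e assume e: "0 < e" "e \<le> e0"
    have sub: "s \<in> ball x d" if "s \<in> ball x e" for s using that e d by (auto simp: e0_def)
    have bd: "\<bar>G 3 s\<bar> \<le> max B1 B2 \<and> \<bar>K 3 s\<bar> \<le> max B1 B2" if "s \<in> ball x e" for s
    proof -
      have z: "complex_of_real (s - x) \<in> cball 0 (d / 2)"
        using that e by (simp add: e0_def dist_real_def abs_minus_commute del: of_real_diff)
      show ?thesis unfolding G_def K_def
        using B1[OF z] B2[OF z] abs_Re_le_cmod[of "(deriv ^^ 3) \<mu> (complex_of_real (s - x))"]
          abs_Re_le_cmod[of "(deriv ^^ 3) \<nu> (complex_of_real (s - x))"] by linarith
    qed
    have feq: "f s = (if s \<ge> x then G 0 s else K 0 s)" if "s \<in> ball x e" for s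
    proof (cases s x rule: linorder_cases)
      case less
      thus ?thesis using r2(2)[of s] that e by (simp add: e0_def dist_real_def)
    next
      case greater
      thus ?thesis using r1(2)[of s] that e by (simp add: e0_def dist_real_def)
    qed (simp add: Gx)
    show "C2_on (ball x e) f"
      by (rule C2_glue(1)[where G = G and K = K and B = "max B1 B2"]) (use e GD KD sub bd eq feq in auto)
    show "\<exists>L. L-lipschitz_on (ball x e) (deriv (deriv f))"
      by (rule exI, rule C2_glue(2)[where G = G and K = K and B = "max B1 B2"]) (use e GD KD sub bd eq feq in auto)
  qed
qed


section \<open>Characteristic polynomials of Hermitian matrices\<close>

text \<open>The Leibniz formula builds the characteristic polynomial from families of degree at most
  1 by finite sums and products.\<close>

lemma poly_family_char_poly:
  assumes "\<And>i j. i < n \<Longrightarrow> j < n \<Longrightarrow> h i j analytic_on {0}"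
  shows "poly_family (\<lambda>z. char_poly (mat n n (\<lambda>(i, j). h i j z)))"
proof -
  define E where "E = (\<lambda>i j z. (if i = j then [:0, 1:] else 0) + [:- h i j z, 0:])"
  have E: "poly_family (E i j)" if "i < n" "j < n" for i j
    unfolding E_def
    by (intro poly_family_add poly_family_const poly_family_linear analytic_intros assms that)
  have "char_poly (mat n n (\<lambda>(i, j). h i j z)) =
    (\<Sum>\<pi>\<in>{\<pi>. \<pi> permutes {0..<n}}. signof \<pi> * (\<Prod>i=0..<n. E i (\<pi> i) z))" for z
  proof -
    define A where "A = char_poly_matrix (mat n n (\<lambda>(i, j). h i j z))"
    have A: "A \<in> carrier_mat n n" unfolding A_def by simp
    have "A $$ (i, \<pi> i) = E i (\<pi> i) z" if "\<pi> permutes {0..<n}" "i \<in> {0..<n}" for \<pi> i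
    proof -
      have "i < n" "\<pi> i < n" using that permutes_in_image[OF that(1), of i] by auto
      thus ?thesis by (simp add: A_def char_poly_matrix_def E_def)
    qed
    thus ?thesis unfolding char_poly_def A_def[symmetric] det_def'[OF A]
      by (intro sum.cong refl arg_cong2[of _ _ _ _ "(*)"] prod.cong) auto
  qed
  moreover have "poly_family (\<lambda>z. \<Sum>\<pi>\<in>{\<pi>. \<pi> permutes {0..<n}}. signof \<pi> * (\<Prod>i=0..<n. E i (\<pi> i) z))"
  proof (intro poly_family_sum poly_family_mult poly_family_const poly_family_prod E)
    fix \<pi> i assume "\<pi> \<in> {\<pi>. \<pi> permutes {0..<n}}" "i \<in> {0..<n}"
    thus "i < n" "\<pi> i < n" using permutes_in_image[of \<pi> "{0..<n}" i] by auto
  qed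
  ultimately show ?thesis by simp
qed

text \<open>The form v* A v equals its own conjugate, and at an eigenvector it is k times the
  positive number |v|^2.\<close>

lemma hermitian_eigenvalue_real:
  assumes A: "A \<in> hermitian_mats n" and k: "eigenvalue A k"
  shows "k \<in> \<real>"
proof -
  have carr: "A \<in> carrier_mat n n" and herm: "\<And>i j. i < n \<Longrightarrow> j < n \<Longrightarrow> A $$ (i, j) = cnj (A $$ (j, i))"
    using A unfolding hermitian_mats_def by blast+
  obtain v where v: "v \<in> carrier_vec n" "v \<noteq> 0\<^sub>v n" "A *\<^sub>v v = k \<cdot>\<^sub>v v"
    using k carr unfolding eigenvalue_def eigenvector_def by auto
  define S where "S = (\<Sum>i<n. \<Sum>j<n. cnj (vec_index v i) * A $$ (i, j) * vec_index v j)"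
  define w where "w = (\<Sum>i<n. (norm (vec_index v i))\<^sup>2)"
  have row: "(\<Sum>j<n. A $$ (i, j) * vec_index v j) = k * vec_index v i" if "i < n" for i
  proof -
    have "vec_index (A *\<^sub>v v) i = (\<Sum>j<n. A $$ (i, j) * vec_index v j)"
      using that carr v(1) by (auto simp: scalar_prod_def lessThan_atLeast0 intro!: sum.cong)
    thus ?thesis using v that by simp
  qed
  have "S = (\<Sum>i<n. cnj (vec_index v i) * (k * vec_index v i))"
    unfolding S_def by (intro sum.cong refl) (simp add: row[symmetric] sum_distrib_left mult.assoc)
  also have "\<dots> = k * of_real w"
    unfolding w_def of_real_sum sum_distrib_left
    by (intro sum.cong) (simp_all only: complex_norm_square mult_ac)
  finally have S: "S = k * of_real w" .
  have "cnj S = (\<Sum>i<n. \<Sum>j<n. vec_index v i * A $$ (j, i) * cnj (vec_index v j))"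
    unfolding S_def cnj_sum by (intro sum.cong refl) (simp add: herm[symmetric])
  also have "\<dots> = S" unfolding S_def by (subst sum.swap) (simp add: mult_ac)
  finally have "cnj k * of_real w = k * of_real w" unfolding S by simp
  moreover have "w \<noteq> 0"
  proof
    assume "w = 0"
    hence "\<forall>i\<in>{..<n}. (norm (vec_index v i))\<^sup>2 = 0" unfolding w_def by (subst (asm) sum_nonneg_eq_0_iff) auto
    hence "vec_index v i = 0" if "i < n" for i using that by simp
    hence "v = 0\<^sub>v n" using v(1) by (intro eq_vecI) auto
    with v(2) show False by contradiction
  qed
  ultimately have "cnj k = k" by simp
  thus ?thesis by (simp add: Reals_cnj_iff)
qed

lemma real_rooted_char_poly:
  assumes "A \<in> hermitian_mats n" shows "real_rooted (char_poly A)"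
proof -
  have "A \<in> carrier_mat n n" using assms unfolding hermitian_mats_def by blast
  thus ?thesis unfolding real_rooted_def
    using hermitian_eigenvalue_real[OF assms] eigenvalue_root_char_poly by blast
qed

lemma lambda_max_root:
  assumes A: "A \<in> hermitian_mats n" and n: "n \<ge> 1"
  shows "poly (char_poly A) (complex_of_real (lambda_max A)) = 0"
    "\<And>r::real. poly (char_poly A) (complex_of_real r) = 0 \<Longrightarrow> r \<le> lambda_max A"
proof -
  have carr: "A \<in> carrier_mat n n" using A unfolding hermitian_mats_def by blast
  define R where "R = {r::real. poly (char_poly A) (complex_of_real r) = 0}"
  have lm: "lambda_max A = Max R"
    by (simp add: lambda_max_def R_def eigenvalue_root_char_poly[OF carr])
  note rr = real_rooted_char_poly[OF A]
  have "complex_of_real ` R \<subseteq> {z. poly (char_poly A) z = 0}" by (auto simp: R_def)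
  hence "finite (complex_of_real ` R)"
    using poly_roots_finite[OF real_rooted_nonzero[OF rr]] finite_subset by blast
  hence fin: "finite R" by (rule finite_imageD) (simp add: inj_on_def)
  have "degree (char_poly A) = n" using degree_monic_char_poly[OF carr] by simp
  then obtain z where z: "poly (char_poly A) z = 0"
    using fundamental_theorem_of_algebra_alt[of "char_poly A"] n by force
  hence "z \<in> \<real>" using rr by (simp add: real_rooted_def)
  hence ne: "R \<noteq> {}" using z by (auto simp: R_def elim: Reals_cases)
  show "poly (char_poly A) (complex_of_real (lambda_max A)) = 0"
    using Max_in[OF fin ne] unfolding lm by (simp add: R_def)
  show "r \<le> lambda_max A" if "poly (char_poly A) (complex_of_real r) = 0" for r
    unfolding lm using that by (intro Max_ge[OF fin]) (simp add: R_def)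
qed

text \<open>Cauchy's bound, uniform near t = 0 because the coefficients are bounded there. It starts
  the recursion with an initial \<open>M\<close>.\<close>

lemma poly_family_monic_roots_bounded:
  assumes p: "poly_family p" and monic: "\<And>t. degree (p t) = n" "\<And>t. coeff (p t) n = 1"
  obtains M where "\<forall>\<^sub>F t in nhds 0. \<forall>z. poly (p t) z = 0 \<longrightarrow> norm z \<le> M"
proof -
  have "\<exists>B. B > 0 \<and> (\<forall>\<^sub>F t in nhds 0. norm (coeff (p t) j) \<le> B)" for j
    using analytic_at_0_bounded[OF poly_family_coeff[OF p]] by blast
  then obtain B where B: "\<And>j. B j > 0" "\<And>j. \<forall>\<^sub>F t in nhds 0. norm (coeff (p t) j) \<le> B j"
    by metis
  have "\<forall>\<^sub>F t in nhds 0. \<forall>j\<in>{..<n}. norm (coeff (p t) j) \<le> B j"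
    by (subst eventually_ball_finite_distrib) (use B in auto)
  hence "\<forall>\<^sub>F t in nhds 0. \<forall>z. poly (p t) z = 0 \<longrightarrow> norm z \<le> max 1 (\<Sum>j<n. B j)"
  proof eventually_elim
    case (elim t)
    show ?case
    proof (intro allI impI)
      fix z assume z: "poly (p t) z = 0"
      show "norm z \<le> max 1 (\<Sum>j<n. B j)"
      proof (cases "norm z \<le> 1")
        case False
        have "n \<noteq> 0" using z monic[of t] poly_eq_sum_le[of "p t" 0 z] by (intro notI) simp
        then obtain n' where n': "n = Suc n'" by (cases n) auto
        have "z ^ n = - (\<Sum>j<n. coeff (p t) j * z ^ j)"
          using z monic[of t] poly_eq_sum_le[of "p t" n z]
          by (simp add: lessThan_Suc_atMost[symmetric] eq_neg_iff_add_eq_0 add.commute)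
        hence "norm z ^ n = norm (\<Sum>j<n. coeff (p t) j * z ^ j)" by (metis norm_minus_cancel norm_power)
        also have "\<dots> \<le> (\<Sum>j<n. B j * norm z ^ n')"
        proof (intro sum_norm_le)
          fix j assume "j \<in> {..<n}"
          thus "norm (coeff (p t) j * z ^ j) \<le> B j * norm z ^ n'"
            using elim False less_imp_le[OF B(1)] n' unfolding norm_mult norm_power
            by (intro mult_mono power_increasing) auto
        qed
        also have "\<dots> = norm z ^ n' * (\<Sum>j<n. B j)"
          by (simp add: sum_distrib_right[symmetric] mult.commute)
        finally have "norm z ^ n' * norm z \<le> norm z ^ n' * (\<Sum>j<n. B j)" by (simp add: n' mult.commute)
        moreover have "norm z ^ n' > 0" using False by (intro zero_less_power) linarith
        ultimately have "norm z \<le> (\<Sum>j<n. B j)" by (simp only: mult_le_cancel_left_pos)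
        thus ?thesis by simp
      qed simp
    qed
  qed
  thus ?thesis using that by blast
qed

text \<open>Convergence at the single real point d/2 gives convergence on the complex disc of that
  radius, hence a holomorphic extension.\<close>

lemma power_series_extension:
  fixes f :: "real \<Rightarrow> complex"
  assumes "\<forall>\<^sub>F t in nhds x. (\<lambda>k. a k * complex_of_real (t - x) ^ k) sums f t"
  obtains h where "h analytic_on {0}" "\<forall>\<^sub>F t in nhds x. h (complex_of_real (t - x)) = f t"
proof -
  define h where "h = (\<lambda>z. \<Sum>k. a k * z ^ k)"
  obtain d where d: "d > 0" "\<And>t. dist t x < d \<Longrightarrow> (\<lambda>k. a k * complex_of_real (t - x) ^ k) sums f t"
    using assms unfolding eventually_nhds_metric by blast
  define K where "K = complex_of_real (d / 2)"
  have "summable (\<lambda>k. a k * K ^ k)"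
    using d(2)[of "x + d / 2"] d(1) unfolding K_def by (simp add: dist_real_def sums_iff)
  hence "h field_differentiable (at z)" if "z \<in> ball 0 (d / 2)" for z
    unfolding h_def field_differentiable_def
    using termdiffs_strong[of a K z] that d(1) by (auto simp: K_def norm_of_real)
  hence "h holomorphic_on ball 0 (d / 2)"
    by (auto simp: holomorphic_on_def intro: field_differentiable_at_within)
  hence "h analytic_on {0}" unfolding analytic_at_ball using d(1) by (intro exI[of _ "d / 2"]) simp
  moreover have "\<forall>\<^sub>F t in nhds x. h (complex_of_real (t - x)) = f t"
    using assms by (rule eventually_mono) (simp add: h_def sums_iff)
  ultimately show ?thesis using that by blast
qed

theorem theorem4p2:
  fixes n :: nat and D :: "real set" and H :: "real \<Rightarrow> complex mat"
  assumes "n \<ge> 1"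
    and "open D"
    and "analytic_hermitian_family n D H"
  shows "\<forall>x. local_maximizer_on D (lambda_max \<circ> H) x \<longrightarrow>
    (\<exists>U. open U \<and> x \<in> U \<and> U \<subseteq> D \<and> C2_on U (lambda_max \<circ> H) \<and>
      (\<exists>L. L-lipschitz_on U (deriv (deriv (lambda_max \<circ> H)))))"
proof (intro allI impI)
  fix x assume "local_maximizer_on D (lambda_max \<circ> H) x"
  hence xD: "x \<in> D" and "\<forall>\<^sub>F t in at x within D. lambda_max (H t) \<le> lambda_max (H x)"
    by (auto simp: local_maximizer_on_def)
  hence max: "\<forall>\<^sub>F t in at x. (lambda_max \<circ> H) t \<le> (lambda_max \<circ> H) x"
    using at_within_open[OF xD assms(2)] by simp
  have herm: "H t \<in> hermitian_mats n" if "t \<in> D" for t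
    using assms(3) that by (simp add: analytic_hermitian_family_def)
  have inD: "\<forall>\<^sub>F t in nhds x. t \<in> D" using assms(2) xD by (rule eventually_nhds_in_open)
  have "\<exists>h. h analytic_on {0} \<and> (\<forall>\<^sub>F t in nhds x. h (complex_of_real (t - x)) = H t $$ (i, j))"
    if ij: "i < n" "j < n" for i j
  proof -
    obtain a where "\<forall>\<^sub>F t in nhds x. (\<lambda>k. a k * complex_of_real (t - x) ^ k) sums (H t $$ (i, j))"
      using assms(3) xD ij unfolding analytic_hermitian_family_def by blast
    from power_series_extension[OF this] show ?thesis by blast
  qed
  then obtain h where h: "\<And>i j. i < n \<Longrightarrow> j < n \<Longrightarrow> h i j analytic_on {0}"
    "\<And>i j. i < n \<Longrightarrow> j < n \<Longrightarrow> \<forall>\<^sub>F t in nhds x. h i j (complex_of_real (t - x)) = H t $$ (i, j)"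
    by metis
  \<comment> \<open>The entries are extended one by one, so the matrix is known to be Hermitian for
    real arguments only; there \<open>p\<close> is the characteristic polynomial of H, shifted to
    x.\<close>
  define p where "p = (\<lambda>z. char_poly (mat n n (\<lambda>(i, j). h i j z)))"
  have p: "poly_family p" unfolding p_def by (rule poly_family_char_poly[OF h(1)])
  have monic: "degree (p z) = n" "coeff (p z) n = 1" for z
    using degree_monic_char_poly[of "mat n n (\<lambda>(i, j). h i j z)" n] by (simp_all add: p_def)
  have "\<forall>\<^sub>F t in nhds x. \<forall>i\<in>{..<n}. \<forall>j\<in>{..<n}. h i j (complex_of_real (t - x)) = H t $$ (i, j)"
    using h(2) by (simp add: eventually_ball_finite_distrib)
  with inD have pH: "\<forall>\<^sub>F t in nhds x. t \<in> D \<and> p (complex_of_real (t - x)) = char_poly (H t)"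
  proof eventually_elim
    case (elim t)
    have "H t \<in> carrier_mat n n" using herm[OF elim(1)] unfolding hermitian_mats_def by blast
    hence "mat n n (\<lambda>(i, j). h i j (complex_of_real (t - x))) = H t"
      using elim(2) by (intro eq_matI) auto
    thus ?case using elim(1) by (simp add: p_def)
  qed
  define F where "F = (\<lambda>t. lambda_max (H (x + t)))"
  have shift: "filterlim (\<lambda>t. x + s * t) (nhds x) (nhds (0::real))" for s
    by (rule tendsto_eq_intros refl filterlim_ident)+ simp
  have F: "\<forall>\<^sub>F t in nhds (0::real). real_rooted (p (of_real t)) \<and> poly (p (of_real t)) (of_real (F t)) = 0 \<and>
     (\<forall>r::real. poly (p (of_real t)) (complex_of_real r) = 0 \<longrightarrow> r \<le> F t)"
    using eventually_compose_filterlim[OF pH shift[of 1]]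
  proof eventually_elim
    case (elim t)
    hence "H (x + t) \<in> hermitian_mats n" "p (of_real t) = char_poly (H (x + t))" using herm by simp_all
    thus ?case using real_rooted_char_poly lambda_max_root[OF _ assms(1)] by (simp add: F_def)
  qed
  note F0 = eventually_nhds_x_imp_x[OF F, simplified]
  \<comment> \<open>Serves both sides: s = 1 goes with \<open>p\<close> itself, and s = -1 with the
    reflected family, for which the right of 0 is the left of x.\<close>
  have branch: "\<exists>\<mu>. \<mu> analytic_on {0} \<and> Re (\<mu> 0) = F 0 \<and>
      (\<forall>\<^sub>F t in at (0::real). Re (\<mu> t) \<le> F (s * t)) \<and> (\<forall>\<^sub>F t in at_right (0::real). F (s * t) = Re (\<mu> t))"
    if fam: "poly_family P" and P: "\<And>t. P (complex_of_real t) = p (of_real (s * t))"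
      and Pmonic: "\<And>z. degree (P z) = n" "\<And>z. coeff (P z) n = 1" for P and s :: real
  proof -
    have "filterlim (\<lambda>t. s * t) (nhds (0::real)) (nhds 0)"
      by (rule tendsto_eq_intros refl filterlim_ident)+ simp
    from eventually_compose_filterlim[OF F this]
    have FP: "\<forall>\<^sub>F t in nhds (0::real). real_rooted (P t) \<and> poly (P t) (of_real (F (s * t))) = 0 \<and>
       (\<forall>r::real. poly (P t) (complex_of_real r) = 0 \<longrightarrow> r \<le> F (s * t))" unfolding P .
    have FPat: "\<forall>\<^sub>F t in at 0 within S. real_rooted (P (complex_of_real t)) \<and> poly (P t) (of_real (F (s * t))) = 0 \<and>
       (\<forall>r::real. poly (P t) (complex_of_real r) = 0 \<longrightarrow> r \<le> F (s * t))" for S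
      using FP by (rule filter_leD[OF at_within_le_nhds])
    have P0: "P 0 = p 0" using P[of 0] by simp
    obtain M where M: "\<forall>\<^sub>F t in nhds 0. \<forall>z. poly (P t) z = 0 \<longrightarrow> norm z \<le> M"
      using poly_family_monic_roots_bounded[OF fam Pmonic] by blast
    have "\<forall>\<^sub>F t in at_right (0::real). \<forall>r::real. poly (P t) (complex_of_real r) = 0 \<longrightarrow> r \<le> M"
      using eventually_of_real_nhds[OF M] by eventually_elim (metis abs_le_D1 norm_of_real)
    moreover have "\<forall>\<^sub>F t in at (0::real). real_rooted (P t)" using FPat by (rule eventually_mono) blast
    moreover have "P 0 \<noteq> 0" using real_rooted_nonzero F0 P0 by simp
    ultimately obtain \<mu> where \<mu>: "\<mu> analytic_on {0}" "\<mu> 0 = of_real (F 0)"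
      "\<forall>\<^sub>F t in at (0::real). poly (P t) (\<mu> t) = 0"
      "\<forall>\<^sub>F t in at_right (0::real). \<forall>r::real. poly (P t) (complex_of_real r) = 0 \<longrightarrow> r \<le> Re (\<mu> t)"
      using largest_root_branch[OF fam, of M "F 0"] F0 P0 by auto
    have le: "\<forall>\<^sub>F t in at (0::real). Re (\<mu> t) \<le> F (s * t)"
      using \<mu>(3) FPat
    proof eventually_elim
      case (elim t)
      hence "of_real (Re (\<mu> t)) = \<mu> t" by (simp add: real_rooted_def of_real_Re)
      thus ?case using elim by metis
    qed
    moreover have "\<forall>\<^sub>F t in at_right (0::real). F (s * t) = Re (\<mu> t)"
      using \<mu>(4) FPat eventually_at_imp_at_within[OF le]
      by eventually_elim (simp add: order_antisym)
    ultimately show ?thesis using \<mu>(1,2) by auto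
  qed
  obtain \<mu> where \<mu>: "\<mu> analytic_on {0}" "Re (\<mu> 0) = F 0"
    "\<forall>\<^sub>F t in at (0::real). Re (\<mu> t) \<le> F t" "\<forall>\<^sub>F t in at_right (0::real). F t = Re (\<mu> t)"
    using branch[OF p, of 1] monic by auto
  obtain \<nu> where \<nu>: "\<nu> analytic_on {0}" "Re (\<nu> 0) = F 0"
    "\<forall>\<^sub>F t in at (0::real). Re (\<nu> t) \<le> F (- t)" "\<forall>\<^sub>F t in at_right (0::real). F (- t) = Re (\<nu> t)"
    using branch[OF poly_family_uminus[OF p], of "-1"] monic by auto
  \<comment> \<open>Undoes the reflection, so that both branches are evaluated at s - x.\<close>
  define \<nu>' where "\<nu>' = (\<lambda>z. \<nu> (- z))"
  have \<nu>': "\<nu>' analytic_on {0}"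
  proof -
    have "(uminus :: complex \<Rightarrow> complex) analytic_on {0}"
      by (rule analytic_on_neg[OF analytic_on_ident])
    from analytic_on_compose_gen[OF this \<nu>(1)] show ?thesis by (simp add: \<nu>'_def o_def)
  qed
  have Fx: "F (t - x) = (lambda_max \<circ> H) t" for t by (simp add: F_def)
  have lim: "filterlim (\<lambda>t. t - x) (at 0) (at x)" "filterlim (\<lambda>t. t - x) (at_right 0) (at_right x)"
    "filterlim (\<lambda>t. x - t) (at 0) (at x)" "filterlim (\<lambda>t. x - t) (at_right 0) (at_left x)"
    by (auto simp: filterlim_at eventually_at_filter intro!: tendsto_eq_intros)
  obtain e0 where e0: "e0 > 0" "\<And>e. 0 < e \<Longrightarrow> e \<le> e0 \<Longrightarrow> C2_on (ball x e) (lambda_max \<circ> H) \<and>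
      (\<exists>L. L-lipschitz_on (ball x e) (deriv (deriv (lambda_max \<circ> H))))"
  proof -
    have "\<exists>e0>0. \<forall>e. 0 < e \<longrightarrow> e \<le> e0 \<longrightarrow> C2_on (ball x e) (lambda_max \<circ> H) \<and>
      (\<exists>L. L-lipschitz_on (ball x e) (deriv (deriv (lambda_max \<circ> H))))"
    proof (rule C2_at_max_of_two_branches[OF \<mu>(1) \<nu>'])
      show "Re (\<mu> 0) = (lambda_max \<circ> H) x" "Re (\<nu>' 0) = (lambda_max \<circ> H) x"
        using \<mu>(2) \<nu>(2) by (simp_all add: \<nu>'_def F_def)
      show "\<forall>\<^sub>F s in at_right x. (lambda_max \<circ> H) s = Re (\<mu> (of_real (s - x)))"
        using eventually_compose_filterlim[OF \<mu>(4) lim(2)] unfolding Fx .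
      show "\<forall>\<^sub>F s in at_left x. (lambda_max \<circ> H) s = Re (\<nu>' (of_real (s - x)))"
        using eventually_compose_filterlim[OF \<nu>(4) lim(4)] unfolding minus_diff_eq Fx \<nu>'_def by simp
      show "\<forall>\<^sub>F s in at x. Re (\<mu> (of_real (s - x))) \<le> (lambda_max \<circ> H) s"
        using eventually_compose_filterlim[OF \<mu>(3) lim(1)] unfolding Fx .
      show "\<forall>\<^sub>F s in at x. Re (\<nu>' (of_real (s - x))) \<le> (lambda_max \<circ> H) s"
        using eventually_compose_filterlim[OF \<nu>(3) lim(3)] unfolding minus_diff_eq Fx \<nu>'_def by simp
    qed (rule max)
    thus ?thesis using that by blast
  qed
  obtain e1 where e1: "e1 > 0" "ball x e1 \<subseteq> D" using openE[OF assms(2) xD] by blast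
  show "\<exists>U. open U \<and> x \<in> U \<and> U \<subseteq> D \<and> C2_on U (lambda_max \<circ> H) \<and>
      (\<exists>L. L-lipschitz_on U (deriv (deriv (lambda_max \<circ> H))))"
  proof (intro exI[of _ "ball x (min e0 e1)"] conjI)
    show "ball x (min e0 e1) \<subseteq> D" using e1(2) by auto
  qed (use e0 e1(1) in auto)
qed

end
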